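(* Let $A\subseteq B$ be a finite-index unital irreducible inclusion of $C^*$-algebras. Then the $E$-compatible intermediate $C^*$-algebras $A\subseteq C\subseteq B$ form a finite lattice.
   Context: A unital inclusion $A\subseteq B$ of $C^*$-algebras has finite index (in the sense of Watatani) if it is equipped with a faithful conditional expectation $E=E_A^B:B\to A$ of finite index, i.e. admitting a finite quasi-basis: elements $u_1,\dots,u_n\in B$ with $x=\sum_k u_kE(u_k^*x)$ for all $x\in B$. The inclusion is irreducible if the relative commutant $A'\cap B=\{b\in B: ab=ba\ \forall a\in A\}$ is one-dimensional. An intermediate $C^*$-subalgebra $A\subseteq C\subseteq B$ is $E$-compatible if there exists a conditional expectation $E_C^B:B\to C$ with $E_A^C\circ E_C^B=E_A^B$, where $E_A^C:=E_A^B|_C$. Intermediate algebras are ordered by inclusion. *)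

theory Defs
  imports "HOL-Analysis.Analysis" "HOL-Algebra.Lattice"
begin

text \<open>
  Unital C*-algebras over the complex numbers. The superclasses supply the real Banach
  algebra with unit; the axiom \<open>norm 1 = 1\<close> among them excludes only the zero algebra.
\<close>

class cstar_algebra = real_normed_algebra_1 + complete_space +
  fixes scaleC :: "complex \<Rightarrow> 'a \<Rightarrow> 'a"  (infixr \<open>*\<^sub>C\<close> 75)
    and star :: "'a \<Rightarrow> 'a"
  assumes scaleC_of_real: "complex_of_real r *\<^sub>C x = r *\<^sub>R x"
    and scaleC_add_right: "c *\<^sub>C (x + y) = c *\<^sub>C x + c *\<^sub>C y"
    and scaleC_add_left: "(c + d) *\<^sub>C x = c *\<^sub>C x + d *\<^sub>C x"
    and scaleC_scaleC: "c *\<^sub>C d *\<^sub>C x = (c * d) *\<^sub>C x"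
    and mult_scaleC_left: "(c *\<^sub>C x) * y = c *\<^sub>C (x * y)"
    and mult_scaleC_right: "x * (c *\<^sub>C y) = c *\<^sub>C (x * y)"
    and norm_scaleC: "norm (c *\<^sub>C x) = cmod c * norm x"
    and star_add: "star (x + y) = star x + star y"
    and star_scaleC: "star (c *\<^sub>C x) = cnj c *\<^sub>C star x"
    and star_mult: "star (x * y) = star y * star x"
    and star_star: "star (star x) = x"
    and cstar_identity: "norm (star x * x) = (norm x)\<^sup>2"

global_interpretation complex_vector:
  vector_space "scaleC :: complex \<Rightarrow> 'a \<Rightarrow> 'a::cstar_algebra"
proof unfold_locales
  fix x :: 'a
  show "1 *\<^sub>C x = x"
    using scaleC_of_real[of 1 x] by simp
qed (simp_all add: scaleC_add_right scaleC_add_left scaleC_scaleC)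

definition cstar_subalgebra :: "'b::cstar_algebra set \<Rightarrow> bool" where
  "cstar_subalgebra C \<longleftrightarrow>
     complex_vector.subspace C \<and>
     (\<forall>x\<in>C. \<forall>y\<in>C. x * y \<in> C) \<and>
     (\<forall>x\<in>C. star x \<in> C) \<and>
     closed C"

definition positive_in :: "'b::cstar_algebra set \<Rightarrow> 'b \<Rightarrow> bool" where
  "positive_in C x \<longleftrightarrow> (\<exists>y\<in>C. x = star y * y)"

text \<open>
  A conditional expectation onto \<open>C\<close>: a positive complex-linear \<open>C\<close>-bimodule
  projection from the ambient algebra onto \<open>C\<close>.
\<close>

definition conditional_expectation ::
    "'b::cstar_algebra set \<Rightarrow> ('b \<Rightarrow> 'b) \<Rightarrow> bool" where
  "conditional_expectation C F \<longleftrightarrow>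
     Vector_Spaces.linear scaleC scaleC F \<and>
     range F \<subseteq> C \<and>
     (\<forall>c\<in>C. F c = c) \<and>
     (\<forall>c\<in>C. \<forall>d\<in>C. \<forall>x. F (c * x * d) = c * F x * d) \<and>
     (\<forall>x. positive_in UNIV x \<longrightarrow> positive_in C (F x))"

definition faithful :: "('b::cstar_algebra \<Rightarrow> 'b) \<Rightarrow> bool" where
  "faithful F \<longleftrightarrow> (\<forall>x. positive_in UNIV x \<and> F x = 0 \<longrightarrow> x = 0)"

definition finite_quasi_basis ::
    "('b::cstar_algebra \<Rightarrow> 'b) \<Rightarrow> nat \<Rightarrow> (nat \<Rightarrow> 'b) \<Rightarrow> bool" where
  "finite_quasi_basis F n u \<longleftrightarrow> (\<forall>x. x = (\<Sum>k<n. u k * F (star (u k) * x)))"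

definition finite_index_inclusion ::
    "'b::cstar_algebra set \<Rightarrow> ('b \<Rightarrow> 'b) \<Rightarrow> bool" where
  "finite_index_inclusion A E \<longleftrightarrow>
     cstar_subalgebra A \<and> 1 \<in> A \<and>
     conditional_expectation A E \<and> faithful E \<and>
     (\<exists>n u. finite_quasi_basis E n u)"

definition relative_commutant :: "'b::cstar_algebra set \<Rightarrow> 'b set" where
  "relative_commutant A = {b. \<forall>a\<in>A. a * b = b * a}"

text \<open>
  The relative commutant is a subspace, and \<open>dim\<close> is \<open>0\<close> on infinite-dimensional spaces,
  so the value \<open>1\<close> does express one-dimensionality over the complex numbers.
\<close>

definition irreducible_inclusion :: "'b::cstar_algebra set \<Rightarrow> bool" where
  "irreducible_inclusion A \<longleftrightarrow> complex_vector.dim (relative_commutant A) = 1"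

text \<open>
  Since \<open>F\<close> maps into \<open>C\<close>, composing with \<open>E\<close> is the same as composing with the
  restriction of \<open>E\<close> to \<open>C\<close>.
\<close>

definition compatible_intermediate ::
    "'b::cstar_algebra set \<Rightarrow> ('b \<Rightarrow> 'b) \<Rightarrow> 'b set \<Rightarrow> bool" where
  "compatible_intermediate A E C \<longleftrightarrow>
     cstar_subalgebra C \<and> A \<subseteq> C \<and>
     (\<exists>F. conditional_expectation C F \<and> E \<circ> F = E)"

definition compatible_order ::
    "'b::cstar_algebra set \<Rightarrow> ('b \<Rightarrow> 'b) \<Rightarrow> 'b set gorder" where
  "compatible_order A E =
     \<lparr>carrier = {C. compatible_intermediate A E C}, eq = (=), le = (\<subseteq>)\<rparr>"

end

theory Submission
  imports Defs
begin

text \<open>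
  Let \<open>E\<close> be the expectation and \<open>u k\<close> the quasi-basis. A compatible intermediate algebra \<open>C\<close> is
  recorded by an expectation \<open>F\<close> onto \<open>C\<close> with \<open>E \<circ> F = E\<close>. It belongs to the space \<open>M\<close> of additive
  \<open>A\<close>-bimodule maps of \<open>B\<close>, and there it is a contractive projection that is self-adjoint for
  the \<open>A\<close>-valued inner product \<open>E (star x * y)\<close>.

  \<^bold>\<open>Finite dimension.\<close> For \<open>S, T \<in> M\<close> the element \<open>\<Sum>k. S (u k) * star (T (u k))\<close> commutes with \<open>A\<close>, so
  by irreducibility it is a number (\<open>sum_mult_star_scalar\<close>). This gives an inner product on \<open>M\<close>.
  Bessel's inequality with coefficients in \<open>B\<close> bounds the length of orthonormal systems
  (\<open>orthonormal_bound\<close>), so \<open>M\<close> is finite-dimensional and bounded sequences in it have convergent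
  subsequences (\<open>bounded_bimodule_maps_subsequence\<close>).

  \<^bold>\<open>Finiteness.\<close> The expectations form a bounded set, so it suffices that they are uniformly
  separated (\<open>close_expectations_subset\<close>). For expectations \<open>F\<close> onto \<open>C\<close> and \<open>G\<close> onto \<open>D\<close>, the map
  \<open>\<Theta> x = (\<Sum>k. G (x * F (u k)) * star (F (u k)))\<close> is multiplication by one number \<open>l\<close> on \<open>C\<close> and on
  \<open>D\<close>. If \<open>G\<close> is close to \<open>F\<close>, then \<open>\<Theta>\<close> is close to a multiple of \<open>F\<close> and \<open>l\<close> is bounded away from
  zero; applied to \<open>d - F d\<close> for \<open>d \<in> D\<close>, which \<open>F\<close> kills, this gives \<open>d = F d\<close>. So \<open>D \<subseteq> C\<close>, and
  \<open>C \<subseteq> D\<close> by symmetry.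

  \<^bold>\<open>Lattice.\<close> The algebra \<open>B\<close> is compatible, and by finiteness joins exist as soon as intersections
  of compatible algebras are compatible (\<open>compatible_Int\<close>). The expectation onto \<open>C \<inter> D\<close> is found by
  minimizing the Hilbert--Schmidt norm of the adjoint among all positive maps that have the
  properties required of it except for the range; the minimum exists because \<open>M\<close> is
  finite-dimensional, and composing with the expectations onto \<open>C\<close> and \<open>D\<close> shows its range to be right.

  \<^bold>\<open>Positivity.\<close> Estimates and limits of positive maps rest on the fact that the elements
  \<open>star y * y\<close> form a closed convex cone. It is derived here from the C*-identity and completeness,
  with a square root given by an iteration in place of spectral theory (\<open>nonneg_sqrt\<close>,
  \<open>nonneg_star_mult\<close>).
\<close>

section \<open>The involution\<close>

lemma star_zero [simp]: "star (0::'a::cstar_algebra) = 0"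
  using star_add[of "0::'a" 0] by simp

lemma star_one [simp]: "star (1::'a::cstar_algebra) = 1"
  by (metis mult_1 mult_1_right star_mult star_star)

lemma star_scaleR [simp]: "star (r *\<^sub>R (x::'a::cstar_algebra)) = r *\<^sub>R star x"
  by (metis complex_cnj_complex_of_real scaleC_of_real star_scaleC)

lemma star_minus [simp]: "star (- (x::'a::cstar_algebra)) = - star x"
  using star_scaleR[of "-1" x] by simp

lemma star_diff [simp]: "star ((x::'a::cstar_algebra) - y) = star x - star y"
  using star_add[of x "-y"] by simp

lemma star_sum: "star (\<Sum>i\<in>I. f i :: 'a::cstar_algebra) = (\<Sum>i\<in>I. star (f i))"
  by (induction I rule: infinite_finite_induct) (auto simp: star_add)

declare star_add [simp] star_star [simp] star_mult [simp]

lemma norm_star_le: "norm (x::'a::cstar_algebra) \<le> norm (star x)"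
proof (cases "x = 0")
  case False
  have "norm x * norm x \<le> norm (star x) * norm x"
    using cstar_identity[of x] norm_mult_ineq[of "star x" x] by (simp add: power2_eq_square)
  then show ?thesis using False by simp
qed simp

lemma norm_star [simp]: "norm (star x) = norm (x::'a::cstar_algebra)"
  using norm_star_le[of x] norm_star_le[of "star x"] by simp

lemma norm_mult_star: "norm (x * star x) = (norm (x::'a::cstar_algebra))\<^sup>2"
  using cstar_identity[of "star x"] by simp

lemma norm_selfadjoint_square:
  "star s = s \<Longrightarrow> norm (s * s) = (norm (s::'a::cstar_algebra))\<^sup>2"
  using cstar_identity[of s] by simp

lemma bounded_linear_star: "bounded_linear (star :: 'a::cstar_algebra \<Rightarrow> 'a)"
  by (rule bounded_linear_intro[of _ 1]) auto

lemmas tendsto_star = bounded_linear.tendsto[OF bounded_linear_star]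

section \<open>Square roots by iteration\<close>

text \<open>
  A limit \<open>y\<close> of this iteration satisfies \<open>2 y = h + y\<^sup>2\<close>, that is \<open>(1 - y)\<^sup>2 = 1 - h\<close>. It yields square
  roots without any spectral theory: each iterate is a polynomial in \<open>h\<close>, so the limit inherits
  commutation relations, self-adjointness and membership in closed subalgebras, and the same
  iteration run at the real number \<open>1\<close> majorizes it in norm.
\<close>

primrec sqrt_iter :: "'a::real_algebra_1 \<Rightarrow> nat \<Rightarrow> 'a" where
  "sqrt_iter h 0 = 0"
| "sqrt_iter h (Suc n) = (1/2) *\<^sub>R (h + sqrt_iter h n * sqrt_iter h n)"

lemma sqrt_iter_real_bounds: "0 \<le> sqrt_iter (1::real) n \<and> sqrt_iter (1::real) n \<le> 1"
  by (induction n) (auto simp: mult_le_one)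

lemma sqrt_iter_real_mono: "sqrt_iter (1::real) n \<le> sqrt_iter 1 (Suc n)"
proof (induction n)
  case (Suc n)
  then have "sqrt_iter (1::real) n * sqrt_iter 1 n \<le> sqrt_iter 1 (Suc n) * sqrt_iter 1 (Suc n)"
    using sqrt_iter_real_bounds[of n] by (intro mult_mono) linarith+
  then show ?case by (simp del: sqrt_iter.simps add: sqrt_iter.simps(2)[of _ n] sqrt_iter.simps(2)[of _ "Suc n"])
qed simp

text \<open>
  Stated for an intertwiner \<open>z\<close> between two elements, not only for a commuting one, because
  \<open>nonneg_intertwiner_zero\<close> compares square roots in two different places.
\<close>

lemma sqrt_iter_intertwine:
  assumes "h * z = z * h'"
  shows "sqrt_iter h n * z = z * sqrt_iter h' n"
proof (induction n)
  case (Suc n)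
  have "(sqrt_iter h n * sqrt_iter h n) * z = z * (sqrt_iter h' n * sqrt_iter h' n)"
    by (metis Suc mult.assoc)
  with assms show ?case by (simp add: algebra_simps)
qed simp

lemma sqrt_iter_commute: "sqrt_iter h m * sqrt_iter h n = sqrt_iter h n * sqrt_iter h m"
  by (rule sqrt_iter_intertwine, rule sqrt_iter_intertwine[symmetric], rule refl)

lemma norm_sqrt_iter:
  fixes h :: "'a::real_normed_algebra_1"
  assumes "norm h \<le> 1"
  shows "norm (sqrt_iter h n) \<le> sqrt_iter 1 n"
proof (induction n)
  case (Suc n)
  have "norm (h + sqrt_iter h n * sqrt_iter h n) \<le> 1 + sqrt_iter 1 n * sqrt_iter 1 n"
    using assms Suc
    by (intro order_trans[OF norm_triangle_ineq] add_mono order_trans[OF norm_mult_ineq] mult_mono)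
       (auto simp: sqrt_iter_real_bounds)
  then show ?case by simp
qed simp

text \<open>
  Iterates commute, so the difference of two consecutive squares factors as for numbers; the
  bound on increments then passes from the real majorant by induction.
\<close>

lemma norm_sqrt_iter_Suc_diff:
  fixes h :: "'a::real_normed_algebra_1"
  assumes "norm h \<le> 1"
  shows "norm (sqrt_iter h (Suc n) - sqrt_iter h n) \<le> sqrt_iter 1 (Suc n) - sqrt_iter 1 n"
proof (induction n)
  case 0
  then show ?case using assms by simp
next
  case (Suc n)
  let ?y = "sqrt_iter h" and ?t = "sqrt_iter (1::real)"
  have eq: "?y (Suc (Suc n)) - ?y (Suc n)
      = (1/2) *\<^sub>R ((?y (Suc n) - ?y n) * (?y (Suc n) + ?y n))"
    using sqrt_iter_commute[of h "Suc n" n]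
    by (simp del: sqrt_iter.simps add: sqrt_iter.simps(2)[of _ n] sqrt_iter.simps(2)[of _ "Suc n"])
       (simp add: algebra_simps)
  have "norm ((?y (Suc n) - ?y n) * (?y (Suc n) + ?y n))
      \<le> (?t (Suc n) - ?t n) * (?t (Suc n) + ?t n)"
    using Suc norm_sqrt_iter[OF assms, of n] norm_sqrt_iter[OF assms, of "Suc n"]
      sqrt_iter_real_mono[of n]
    by (intro order_trans[OF norm_mult_ineq] mult_mono order_trans[OF norm_triangle_ineq] add_mono)
       (auto simp del: sqrt_iter.simps)
  also have "\<dots> = 2 * (?t (Suc (Suc n)) - ?t (Suc n))"
  proof -
    have t: "2 * ?t (Suc k) = 1 + ?t k * ?t k" for k by simp
    show ?thesis using t[of n] t[of "Suc n"] by (simp add: algebra_simps del: sqrt_iter.simps)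
  qed
  finally show ?case unfolding eq by (simp del: sqrt_iter.simps)
qed

lemma norm_sqrt_iter_diff:
  fixes h :: "'a::real_normed_algebra_1"
  assumes "norm h \<le> 1" "m \<le> n"
  shows "norm (sqrt_iter h n - sqrt_iter h m) \<le> sqrt_iter 1 n - sqrt_iter 1 m"
  using assms(2)
proof (induction n rule: dec_induct)
  case (step n)
  then show ?case
    using norm_sqrt_iter_Suc_diff[OF assms(1), of n]
      norm_triangle_ineq[of "sqrt_iter h (Suc n) - sqrt_iter h n" "sqrt_iter h n - sqrt_iter h m"]
    by (simp del: sqrt_iter.simps)
qed simp

definition sqrt_one_minus :: "'a::real_normed_algebra_1 \<Rightarrow> 'a" where
  "sqrt_one_minus h = 1 - lim (sqrt_iter h)"

lemma sqrt_iter_tendsto: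
  fixes h :: "'a::cstar_algebra"
  assumes "norm h \<le> 1"
  shows "sqrt_iter h \<longlonglongrightarrow> 1 - sqrt_one_minus h"
proof -
  have "monoseq (sqrt_iter (1::real))"
    by (intro incseq_imp_monoseq incseq_SucI sqrt_iter_real_mono)
  moreover have "Bseq (sqrt_iter (1::real))"
    by (rule BseqI'[of _ 1]) (use sqrt_iter_real_bounds in auto)
  ultimately have "Cauchy (sqrt_iter (1::real))"
    using Bseq_monoseq_convergent convergent_Cauchy by blast
  have "Cauchy (sqrt_iter h)"
  proof (rule metric_CauchyI)
    fix e :: real assume "0 < e"
    then obtain N where N: "\<And>m n. m \<ge> N \<Longrightarrow> n \<ge> N \<Longrightarrow> dist (sqrt_iter (1::real) m) (sqrt_iter 1 n) < e"
      using metric_CauchyD[OF \<open>Cauchy (sqrt_iter (1::real))\<close>] by blast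
    have *: "dist (sqrt_iter h m) (sqrt_iter h n) < e" if "m \<ge> N" "n \<ge> N" "m \<le> n" for m n
      using norm_sqrt_iter_diff[OF assms that(3)] N[OF that(1,2)]
      by (simp add: dist_norm norm_minus_commute)
    then show "\<exists>N. \<forall>m\<ge>N. \<forall>n\<ge>N. dist (sqrt_iter h m) (sqrt_iter h n) < e"
      by (metis dist_commute nle_le)
  qed
  then have "convergent (sqrt_iter h)" by (rule Cauchy_convergent)
  then show ?thesis by (simp add: sqrt_one_minus_def convergent_LIMSEQ_iff)
qed

lemma sqrt_one_minus_square:
  fixes h :: "'a::cstar_algebra"
  assumes "norm h \<le> 1"
  shows "sqrt_one_minus h * sqrt_one_minus h = 1 - h"
proof -
  define y where "y = 1 - sqrt_one_minus h"
  have y: "sqrt_iter h \<longlonglongrightarrow> y" using sqrt_iter_tendsto[OF assms] by (simp add: y_def)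
  have "(\<lambda>n. (1/2) *\<^sub>R (h + sqrt_iter h n * sqrt_iter h n)) \<longlonglongrightarrow> (1/2) *\<^sub>R (h + y * y)"
    by (intro tendsto_intros y)
  moreover have "(\<lambda>n. sqrt_iter h (Suc n)) \<longlonglongrightarrow> y" using y by (rule LIMSEQ_Suc)
  ultimately have "y = (1/2) *\<^sub>R (h + y * y)" by (simp add: LIMSEQ_unique)
  then have "2 *\<^sub>R y = 2 *\<^sub>R ((1/2) *\<^sub>R (h + y * y))" by simp
  then have "y + y = h + y * y" by (simp add: scaleR_2)
  moreover have "(1 - y) * (1 - y) = 1 - (y + y) + y * y" by (simp add: algebra_simps)
  ultimately show ?thesis by (simp add: y_def)
qed

lemma sqrt_one_minus_intertwine:
  fixes h :: "'a::cstar_algebra"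
  assumes "norm h \<le> 1" "norm h' \<le> 1" "h * z = z * h'"
  shows "sqrt_one_minus h * z = z * sqrt_one_minus h'"
proof -
  have "(\<lambda>n. sqrt_iter h n * z) \<longlonglongrightarrow> (1 - sqrt_one_minus h) * z"
    by (intro tendsto_intros sqrt_iter_tendsto assms)
  moreover have "(\<lambda>n. z * sqrt_iter h' n) \<longlonglongrightarrow> z * (1 - sqrt_one_minus h')"
    by (intro tendsto_intros sqrt_iter_tendsto assms)
  ultimately have "(1 - sqrt_one_minus h) * z = z * (1 - sqrt_one_minus h')"
    using sqrt_iter_intertwine[OF assms(3)] by (simp add: LIMSEQ_unique)
  then show ?thesis by (simp add: algebra_simps)
qed

lemma norm_one_minus_sqrt_one_minus:
  fixes h :: "'a::cstar_algebra"
  assumes "norm h \<le> 1"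
  shows "norm (1 - sqrt_one_minus h) \<le> 1"
proof (rule Lim_norm_ubound[OF _ sqrt_iter_tendsto[OF assms]])
  have "norm (sqrt_iter h n) \<le> 1" for n
    using norm_sqrt_iter[OF assms, of n] sqrt_iter_real_bounds[of n] by linarith
  then show "\<forall>\<^sub>F n in sequentially. norm (sqrt_iter h n) \<le> 1" by simp
qed simp

lemma star_sqrt_one_minus:
  fixes h :: "'a::cstar_algebra"
  assumes "norm h \<le> 1" "star h = h"
  shows "star (sqrt_one_minus h) = sqrt_one_minus h"
proof -
  have "star (sqrt_iter h n) = sqrt_iter h n" for n
    by (induction n) (auto simp: assms)
  then have "star (1 - sqrt_one_minus h) = 1 - sqrt_one_minus h"
    using tendsto_star[OF sqrt_iter_tendsto[OF assms(1)]] sqrt_iter_tendsto[OF assms(1)]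
    by (simp add: LIMSEQ_unique)
  then show ?thesis by simp
qed

lemma cstar_subalgebra_scaleR:
  "cstar_subalgebra C \<Longrightarrow> x \<in> C \<Longrightarrow> r *\<^sub>R x \<in> C"
  unfolding cstar_subalgebra_def by (metis complex_vector.subspace_scale scaleC_of_real)

lemma cstar_subalgebra_closed:
  assumes "cstar_subalgebra C"
  shows "x \<in> C \<Longrightarrow> y \<in> C \<Longrightarrow> x + y \<in> C" "x \<in> C \<Longrightarrow> y \<in> C \<Longrightarrow> x - y \<in> C"
    "x \<in> C \<Longrightarrow> y \<in> C \<Longrightarrow> x * y \<in> C" "x \<in> C \<Longrightarrow> star x \<in> C" "0 \<in> C" "closed C"
  using assms unfolding cstar_subalgebra_def
  by (auto intro: complex_vector.subspace_add complex_vector.subspace_diff complex_vector.subspace_0)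

lemma sqrt_one_minus_in_subalgebra:
  fixes h :: "'a::cstar_algebra"
  assumes "norm h \<le> 1" "cstar_subalgebra C" "1 \<in> C" "h \<in> C"
  shows "sqrt_one_minus h \<in> C"
proof -
  note closed = cstar_subalgebra_closed[OF assms(2)] cstar_subalgebra_scaleR[OF assms(2)]
  have "sqrt_iter h n \<in> C" for n
    by (induction n) (auto simp: assms closed)
  then have "1 - sqrt_one_minus h \<in> C"
    using closed(6) sqrt_iter_tendsto[OF assms(1)] closed_sequentially by blast
  from closed(2)[OF assms(3) this] show ?thesis by simp
qed

section \<open>The positive cone of a C*-algebra\<close>

text \<open>
  Positivity of a self-adjoint element is expressed by a norm inequality: its spectrum lies within
  distance \<open>t\<close> of \<open>t\<close>, hence in \<open>{0..}\<close>. In this form sums and limits are immediate. That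
  these are exactly the elements \<open>star y * y\<close> is the content of \<open>nonneg_sqrt\<close> and
  \<open>nonneg_star_mult\<close>.
\<close>

definition nonneg :: "'a::cstar_algebra \<Rightarrow> bool" where
  "nonneg x \<longleftrightarrow> star x = x \<and> (\<exists>t. norm (t *\<^sub>R 1 - x) \<le> t)"

lemma nonneg_star: "nonneg x \<Longrightarrow> star x = x"
  by (simp add: nonneg_def)

lemma nonneg_zero [simp]: "nonneg 0"
  unfolding nonneg_def by (auto intro: exI[of _ 0])

lemma nonneg_add:
  assumes "nonneg x" "nonneg y" shows "nonneg (x + y)"
proof -
  obtain s t where "norm (s *\<^sub>R 1 - x) \<le> s" "norm (t *\<^sub>R 1 - y) \<le> t"
    using assms unfolding nonneg_def by blast
  then have "norm ((s + t) *\<^sub>R 1 - (x + y)) \<le> s + t"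
    using norm_triangle_ineq[of "s *\<^sub>R 1 - x" "t *\<^sub>R 1 - y"] by (simp add: algebra_simps)
  then show ?thesis using assms unfolding nonneg_def by auto
qed

lemma nonneg_sum: "(\<And>i. i \<in> I \<Longrightarrow> nonneg (f i)) \<Longrightarrow> nonneg (\<Sum>i\<in>I. f i)"
  by (induction I rule: infinite_finite_induct) (auto intro: nonneg_add)

lemma nonneg_scaleR:
  assumes "nonneg x" "0 \<le> r" shows "nonneg (r *\<^sub>R x)"
proof -
  obtain t where "norm (t *\<^sub>R 1 - x) \<le> t" using assms unfolding nonneg_def by blast
  then have "norm ((r * t) *\<^sub>R 1 - r *\<^sub>R x) \<le> r * t"
    using assms(2) norm_scaleR[of r "t *\<^sub>R 1 - x"] by (simp add: scaleR_diff_right mult_left_mono)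
  then show ?thesis using assms unfolding nonneg_def by auto
qed

lemma nonneg_scaleR_one: "0 \<le> r \<Longrightarrow> nonneg (r *\<^sub>R 1)"
  unfolding nonneg_def by (auto intro: exI[of _ r])

lemma nonneg_norm_minus: "star h = h \<Longrightarrow> norm h \<le> t \<Longrightarrow> nonneg (t *\<^sub>R 1 - h)"
  unfolding nonneg_def by (auto intro: exI[of _ t])

text \<open>
  Rescaling by \<open>t\<close> brings \<open>h\<close> to the form \<open>1 - g\<close> with \<open>g\<close> in the unit ball. The root is given
  explicitly, so that roots of two elements taken with the same \<open>t\<close> can be compared.
\<close>

lemma nonneg_sqrt_exists:
  fixes h :: "'a::cstar_algebra"
  assumes "star h = h" "norm (t *\<^sub>R 1 - h) \<le> t" "t > 0"
  defines "s \<equiv> sqrt t *\<^sub>R sqrt_one_minus (1 - (1/t) *\<^sub>R h)"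
  shows "s * s = h" "nonneg s" "\<And>C. cstar_subalgebra C \<Longrightarrow> 1 \<in> C \<Longrightarrow> h \<in> C \<Longrightarrow> s \<in> C"
    "\<And>z. h * z = z * h \<Longrightarrow> s * z = z * s"
proof -
  define g where "g = 1 - (1/t) *\<^sub>R h"
  have "g = (1/t) *\<^sub>R (t *\<^sub>R 1 - h)" using assms(3) by (simp add: g_def scaleR_diff_right)
  then have "norm g = (1/t) * norm (t *\<^sub>R 1 - h)" using assms(3) by simp
  then have g: "norm g \<le> 1" using assms(2,3) by simp
  have sg: "star g = g" by (simp add: g_def assms)
  have s: "s = sqrt t *\<^sub>R sqrt_one_minus g" by (simp add: s_def g_def)
  show "s * s = h"
    using assms(3) by (simp add: s sqrt_one_minus_square[OF g]) (simp add: g_def)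
  have "sqrt t *\<^sub>R 1 - s = sqrt t *\<^sub>R (1 - sqrt_one_minus g)" by (simp add: s scaleR_diff_right)
  then have "norm (sqrt t *\<^sub>R 1 - s) \<le> sqrt t"
    using norm_one_minus_sqrt_one_minus[OF g] assms(3) by (simp add: mult_left_le)
  then show "nonneg s"
    unfolding nonneg_def using star_sqrt_one_minus[OF g sg] by (auto simp: s)
  show "s \<in> C" if "cstar_subalgebra C" "1 \<in> C" "h \<in> C" for C
    unfolding s using that g
    by (intro cstar_subalgebra_scaleR sqrt_one_minus_in_subalgebra)
       (auto simp: g_def intro!: cstar_subalgebra_closed cstar_subalgebra_scaleR)
  show "s * z = z * s" if "h * z = z * h" for z
    unfolding s using sqrt_one_minus_intertwine[OF g g, of z] that
    by (simp add: g_def algebra_simps)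
qed

lemma nonneg_sqrt:
  fixes h :: "'a::cstar_algebra"
  assumes "nonneg h"
  obtains s where "s * s = h" "nonneg s"
    "\<And>C. cstar_subalgebra C \<Longrightarrow> 1 \<in> C \<Longrightarrow> h \<in> C \<Longrightarrow> s \<in> C"
    "\<And>z. h * z = z * h \<Longrightarrow> s * z = z * s"
proof -
  obtain t where h: "star h = h" and t: "norm (t *\<^sub>R 1 - h) \<le> t"
    using assms unfolding nonneg_def by blast
  \<comment> \<open>The witness \<open>t\<close> may be \<open>0\<close>; enlarging it by one makes it positive.\<close>
  then have "norm ((t + 1) *\<^sub>R 1 - h) \<le> t + 1"
    using norm_triangle_ineq[of "t *\<^sub>R 1 - h" 1] by (simp add: algebra_simps)
  moreover have "t + 1 > 0" using t norm_ge_zero[of "t *\<^sub>R 1 - h"] by linarith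
  ultimately show ?thesis using nonneg_sqrt_exists[OF h, of "t + 1"] that by blast
qed

text \<open>
  For commuting self-adjoint elements \<open>v = r + i s\<close> is normal with \<open>star v * v = r\<^sup>2 + s\<^sup>2\<close>, a scalar,
  and \<open>r\<close> is the real part of \<open>v\<close>. The C*-identity for \<open>v\<close> thus replaces the spectral radius
  formula.
\<close>

lemma norm_le_of_squares_sum:
  fixes r s :: "'a::cstar_algebra"
  assumes "star r = r" "star s = s" "r * s = s * r" "r * r + s * s = t *\<^sub>R 1" "t \<ge> 0"
  shows "(norm r)\<^sup>2 \<le> t"
proof -
  define v where "v = r + \<i> *\<^sub>C s"
  have sv: "star v = r - \<i> *\<^sub>C s"
    using assms by (simp add: v_def star_scaleC)
  have "star v * v = t *\<^sub>R 1"
    using assms(3,4) unfolding sv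
    by (simp add: v_def algebra_simps mult_scaleC_left mult_scaleC_right scaleC_scaleC)
  then have v: "(norm v)\<^sup>2 = \<bar>t\<bar>" using cstar_identity[of v] by simp
  have "2 *\<^sub>R r = v + star v" unfolding sv by (simp add: v_def scaleR_2)
  then have "2 * norm r \<le> 2 * norm v"
    by (metis norm_scaleR abs_numeral norm_triangle_ineq norm_star mult_2 )
  then have "(norm r)\<^sup>2 \<le> (norm v)\<^sup>2" by (simp add: power_mono)
  then show ?thesis using v \<open>t \<ge> 0\<close> by simp
qed

lemma norm_le_of_nonneg_sum:
  fixes r s :: "'a::cstar_algebra"
  assumes "nonneg r" "nonneg s" "r * s = s * r" "r + s = t *\<^sub>R 1" "t \<ge> 0"
  shows "norm r \<le> t"
proof -
  obtain a where a: "a * a = r" "nonneg a" "\<And>z. r * z = z * r \<Longrightarrow> a * z = z * a"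
    using nonneg_sqrt[OF assms(1)] by metis
  obtain b where b: "b * b = s" "nonneg b" "\<And>z. s * z = z * s \<Longrightarrow> b * z = z * b"
    using nonneg_sqrt[OF assms(2)] by metis
  have "b * a = a * b" using a(3)[OF assms(3)] b(3) by metis
  moreover have "a * a + b * b = t *\<^sub>R 1" using a(1) b(1) assms(4) by simp
  ultimately have "(norm a)\<^sup>2 \<le> t"
    using norm_le_of_squares_sum[of a b t] nonneg_star[OF a(2)] nonneg_star[OF b(2)] assms(5) by simp
  then show ?thesis using norm_selfadjoint_square[OF nonneg_star[OF a(2)]] a(1) by simp
qed

lemma norm_le_of_nonneg:
  assumes "nonneg a" "nonneg (t *\<^sub>R 1 - a)" "0 \<le> t" shows "norm a \<le> t"
  using assms by (intro norm_le_of_nonneg_sum[of a "t *\<^sub>R 1 - a"]) (auto simp: algebra_simps)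

text \<open>
  With \<open>t\<close> the square of the norm of \<open>s\<close>, the element \<open>t - s\<^sup>2\<close> has a root \<open>r\<close>; then
  \<open>r\<^sup>2 + s\<^sup>2 = t\<close>, and the previous bound controls \<open>r\<close>, that is \<open>t - s\<^sup>2\<close>.
\<close>

lemma norm_minus_square_le:
  fixes s :: "'a::cstar_algebra"
  assumes "star s = s"
  shows "norm (((norm s)\<^sup>2) *\<^sub>R 1 - s * s) \<le> (norm s)\<^sup>2"
proof (cases "s = 0")
  case False
  define t where "t = (norm s)\<^sup>2"
  have t: "t > 0" using False by (simp add: t_def)
  have "norm (t *\<^sub>R 1 - (t *\<^sub>R 1 - s * s)) \<le> t"
    using norm_selfadjoint_square[OF assms] by (simp add: t_def)
  from nonneg_sqrt_exists[OF _ this t]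
  obtain r where r: "r * r = t *\<^sub>R 1 - s * s" "nonneg r"
    "\<And>z. (t *\<^sub>R 1 - s * s) * z = z * (t *\<^sub>R 1 - s * s) \<Longrightarrow> r * z = z * r"
    using assms by fastforce
  have "(norm r)\<^sup>2 \<le> t"
    using r(1) t nonneg_star[OF r(2)] assms
    by (intro norm_le_of_squares_sum[of r s] r(3)) (auto simp: algebra_simps)
  then show ?thesis
    using norm_selfadjoint_square[OF nonneg_star[OF r(2)]] r(1) by (simp add: t_def)
qed simp

lemma nonneg_selfadjoint_square: "star s = s \<Longrightarrow> nonneg (s * (s::'a::cstar_algebra))"
  unfolding nonneg_def using norm_minus_square_le[of s] by auto

text \<open>
  The number \<open>t\<close> in the definition of positivity can always be taken to be the norm. This uniform
  choice makes the cone closed.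
\<close>

lemma nonneg_norm_bound:
  assumes "nonneg h" shows "norm (norm h *\<^sub>R 1 - h) \<le> norm h"
proof -
  obtain s where s: "s * s = h" "nonneg s" using nonneg_sqrt[OF assms] by metis
  show ?thesis
    using norm_minus_square_le[OF nonneg_star[OF s(2)]] norm_selfadjoint_square[OF nonneg_star[OF s(2)]] s(1)
    by simp
qed

lemma closed_nonneg: "closed {x::'a::cstar_algebra. nonneg x}"
proof (unfold closed_sequential_limits, intro allI impI, elim conjE)
  fix f and l :: 'a assume f: "\<forall>n. f n \<in> {x. nonneg x}" and l: "f \<longlonglongrightarrow> l"
  have "(\<lambda>n. star (f n)) \<longlonglongrightarrow> star l" by (rule tendsto_star[OF l])
  then have "star l = l" using f l by (simp add: nonneg_star LIMSEQ_unique)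
  moreover have "norm (norm l *\<^sub>R 1 - l) \<le> norm l"
  proof (rule tendsto_le)
    show "(\<lambda>n. norm (norm (f n) *\<^sub>R 1 - f n)) \<longlonglongrightarrow> norm (norm l *\<^sub>R 1 - l)"
      by (intro tendsto_intros l)
    show "(\<lambda>n. norm (f n)) \<longlonglongrightarrow> norm l" by (intro tendsto_intros l)
  qed (use f nonneg_norm_bound in \<open>auto intro!: always_eventually\<close>)
  ultimately show "l \<in> {x. nonneg x}" unfolding nonneg_def by auto
qed

lemma nonneg_antisym:
  fixes h :: "'a::cstar_algebra"
  assumes "nonneg h" "nonneg (- h)" shows "h = 0"
  using norm_le_of_nonneg[OF assms(1), of 0] assms(2) by simp

lemma norm_mono_nonneg:
  assumes "nonneg a" "nonneg b" shows "norm a \<le> norm (a + b)"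
proof (rule norm_le_of_nonneg[OF assms(1)])
  have "nonneg (norm (a + b) *\<^sub>R 1 - (a + b))"
    using nonneg_star[OF nonneg_add[OF assms]] by (intro nonneg_norm_minus) auto
  from nonneg_add[OF this assms(2)] show "nonneg (norm (a + b) *\<^sub>R 1 - a)" by simp
qed simp

lemma nonneg_conjugate_commuting:
  fixes a q :: "'a::cstar_algebra"
  assumes "nonneg a" "star q = q" "a * q = q * a"
  shows "nonneg (q * a * q)"
proof -
  obtain b where b: "b * b = a" "nonneg b" "\<And>z. a * z = z * a \<Longrightarrow> b * z = z * b"
    using nonneg_sqrt[OF assms(1)] by metis
  have bq: "b * q = q * b" by (rule b(3)[OF assms(3)])
  have "q * a * q = (b * q) * (b * q)" using bq b(1) by (metis mult.assoc)
  moreover have "star (b * q) = b * q" using bq b(2) assms(2) by (simp add: nonneg_star)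
  ultimately show ?thesis by (simp add: nonneg_selfadjoint_square del: star_mult)
qed

lemma nonneg_sqrt_unique:
  fixes a b :: "'a::cstar_algebra"
  assumes "nonneg a" "nonneg b" "a * b = b * a" "a * a = b * b"
  shows "a = b"
proof -
  define d where "d = a - b"
  have sd: "star d = d" using assms by (simp add: d_def nonneg_star)
  have "d * (a + b) = 0" using assms(3,4) by (simp add: d_def algebra_simps)
  then have "d * (a + b) * d = 0" by simp
  then have sum: "d * a * d + d * b * d = 0" by (simp add: algebra_simps)
  have "a * d = d * a" "b * d = d * b" using assms(3) by (simp_all add: d_def algebra_simps)
  then have "nonneg (d * a * d)" "nonneg (d * b * d)"
    using assms(1,2) sd by (auto intro: nonneg_conjugate_commuting)
  moreover have "d * b * d = - (d * a * d)" using sum by (simp add: eq_neg_iff_add_eq_0 add.commute)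
  ultimately have "d * a * d = 0" by (intro nonneg_antisym) auto
  with sum have "d * a * d = 0" "d * b * d = 0" by auto
  moreover have "d * d * d = d * a * d - d * b * d" by (simp add: d_def algebra_simps)
  ultimately have "d * d * d = 0" by simp
  then have "(d * d) * (d * d) = 0" by (metis mult.assoc mult_zero_right mult_zero_left)
  then have "d = 0" using norm_selfadjoint_square[of d] norm_selfadjoint_square[of "d * d"] sd by auto
  then show ?thesis by (simp add: d_def)
qed

text \<open>
  The step in the Kelley--Vaught theorem that usually compares the spectra of \<open>star z * z\<close> and
  \<open>z * star z\<close>. Put \<open>c = z * star z\<close> and \<open>k = - star z * z\<close>, so that \<open>c z = - z k\<close> and hence
  \<open>c\<^sup>2 z = z k\<^sup>2\<close>. Taking square roots gives \<open>c z = z k\<close>, since \<open>c\<close> and \<open>k\<close> are positive.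
  Both relations together force \<open>z k = 0\<close>.
\<close>

lemma nonneg_intertwiner_zero:
  fixes z :: "'a::cstar_algebra"
  assumes "nonneg (- (star z * z))" "nonneg (z * star z)"
  shows "z = 0"
proof -
  define k where "k = - (star z * z)"
  define c where "c = z * star z"
  \<comment> \<open>A common scale \<open>t\<close> makes the two square roots limits of the same polynomials.\<close>
  define t where "t = max 1 (max (norm (c * c)) (norm (k * k)))"
  define rc where "rc = sqrt t *\<^sub>R sqrt_one_minus (1 - (1/t) *\<^sub>R (c * c))"
  define rk where "rk = sqrt t *\<^sub>R sqrt_one_minus (1 - (1/t) *\<^sub>R (k * k))"
  have t: "t > 0" by (simp add: t_def)
  have c: "nonneg c" and k: "nonneg k" using assms by (simp_all add: c_def k_def)
  have cz: "c * z = - (z * k)" by (simp add: c_def k_def mult.assoc)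
  have "c * c * z = - (c * z * k)" by (metis cz mult.assoc mult_minus_right)
  also have "\<dots> = z * (k * k)" unfolding cz by (simp add: mult.assoc)
  finally have ccz: "c * c * z = z * (k * k)" .
  have bound: "norm (t *\<^sub>R 1 - h * h) \<le> t" if "nonneg h" "norm (h * h) \<le> t" for h :: 'a
  proof -
    have "t *\<^sub>R 1 - h * h = (t - norm (h*h)) *\<^sub>R 1 + (norm (h*h) *\<^sub>R 1 - h * h)"
      by (simp add: algebra_simps)
    then have "norm (t *\<^sub>R 1 - h * h) \<le> norm ((t - norm (h*h)) *\<^sub>R (1::'a)) + norm (norm (h*h) *\<^sub>R 1 - h * h)"
      by (metis norm_triangle_ineq)
    then show ?thesis
      using nonneg_norm_bound[OF nonneg_selfadjoint_square[OF nonneg_star[OF that(1)]]] that(2) by simp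
  qed
  have bc: "norm (t *\<^sub>R 1 - c * c) \<le> t" and bk: "norm (t *\<^sub>R 1 - k * k) \<le> t"
    using bound[OF c] bound[OF k] by (auto simp: t_def)
  note sc = nonneg_sqrt_exists[OF _ bc t, folded rc_def]
  note sk = nonneg_sqrt_exists[OF _ bk t, folded rk_def]
  have stc: "star (c * c) = c * c" and stk: "star (k * k) = k * k"
    using c k by (simp_all add: nonneg_star)
  have "rc = c"
    by (rule nonneg_sqrt_unique[OF sc(2)[OF stc] c sc(4)[OF stc] sc(1)[OF stc]]) (rule mult.assoc)
  moreover have "rk = k"
    by (rule nonneg_sqrt_unique[OF sk(2)[OF stk] k sk(4)[OF stk] sk(1)[OF stk]]) (rule mult.assoc)
  moreover have "rc * z = z * rk"
  proof -
    have n: "norm (1 - (1/t) *\<^sub>R g) \<le> 1" if "norm (t *\<^sub>R 1 - g) \<le> t" for g :: 'a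
    proof -
      have "1 - (1/t) *\<^sub>R g = (1/t) *\<^sub>R (t *\<^sub>R 1 - g)" using t by (simp add: scaleR_diff_right)
      then have "norm (1 - (1/t) *\<^sub>R g) = (1/t) * norm (t *\<^sub>R 1 - g)" using t by simp
      then show ?thesis using that t by simp
    qed
    have "sqrt_one_minus (1 - (1/t) *\<^sub>R (c * c)) * z = z * sqrt_one_minus (1 - (1/t) *\<^sub>R (k * k))"
      using ccz by (intro sqrt_one_minus_intertwine n bc bk) (simp add: algebra_simps)
    then show ?thesis by (simp add: rc_def rk_def)
  qed
  ultimately have "z * k = - (z * k)" using cz by simp
  then have "2 *\<^sub>R (z * k) = 0" by (simp add: scaleR_2 eq_neg_iff_add_eq_0)
  then have "z * k = 0" by simp
  then have "k * k = 0" by (metis k_def mult.assoc mult_minus_left mult_zero_right neg_equal_0_iff_equal)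
  then have "k = 0" using norm_selfadjoint_square[OF nonneg_star[OF k]] by simp
  then show "z = 0" using cstar_identity[of z] by (simp add: k_def)
qed

lemma real_imaginary_decomposition:
  fixes x :: "'a::cstar_algebra"
  obtains a b where "star a = a" "star b = b" "x = a + \<i> *\<^sub>C b"
proof
  define a where "a = (1/2) *\<^sub>R (x + star x)"
  define b where "b = (- \<i> / 2) *\<^sub>C (x - star x)"
  show "star a = a" by (simp add: a_def add.commute)
  have "star b = (\<i> / 2) *\<^sub>C (star x - x)" by (simp add: b_def star_scaleC)
  also have "\<dots> = b" 
    by (simp add: b_def complex_vector.scale_right_diff_distrib)
  finally show "star b = b" .
  have "\<i> *\<^sub>C b = (1/2) *\<^sub>R (x - star x)"
    unfolding b_def scaleC_scaleC by (simp flip: scaleC_of_real)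
  moreover have "x = (1/2) *\<^sub>R (x + star x) + (1/2) *\<^sub>R (x - star x)"
    by (simp flip: scaleR_add_right scaleR_2 scaleR_left_distrib add: scaleR_add_right[symmetric])
  ultimately show "x = a + \<i> *\<^sub>C b" by (simp add: a_def)
qed

text \<open>
  With \<open>h = star y * y\<close> and \<open>a\<close> the positive root of \<open>h\<^sup>2\<close>, the element \<open>q = a - h\<close> is twice
  the negative part of \<open>h\<close>. For \<open>z = y q\<close> the element \<open>star z * z = q h q\<close> is negative, while
  \<open>z * star z\<close> is positive because \<open>star z * z + z * star z\<close> is a sum of squares of self-adjoint
  elements. So \<open>z = 0\<close>, whence \<open>q\<^sup>3 = 0\<close> and \<open>h = a\<close>.
\<close>

lemma nonneg_star_mult:
  fixes y :: "'a::cstar_algebra"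
  shows "nonneg (star y * y)"
proof -
  define h where "h = star y * y"
  have h: "star h = h" by (simp add: h_def)
  obtain a where a: "a * a = h * h" "nonneg a" "\<And>z. h * h * z = z * (h * h) \<Longrightarrow> a * z = z * a"
    using nonneg_sqrt[OF nonneg_selfadjoint_square[OF h]] by metis
  have ah: "a * h = h * a" by (rule a(3)) (simp add: mult.assoc)
  define q where "q = a - h"
  have q: "star q = q" using h a(2) by (simp add: q_def nonneg_star)
  have aq: "a * q = q * a" using ah by (simp add: q_def algebra_simps)
  have qhq: "- (q * h * q) = q * a * q"
  proof -
    \<comment> \<open>Here \<open>a + h\<close> is twice the positive part of \<open>h\<close>.\<close>
    have "q * (a + h) = 0" using a(1) ah by (simp add: q_def algebra_simps)
    then have "q * (a + h) * q = 0" by simp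
    then show ?thesis by (simp add: algebra_simps add_eq_0_iff2)
  qed
  define z where "z = y * q"
  have zz: "star z * z = q * h * q" using q by (simp add: z_def h_def mult.assoc)
  have k: "nonneg (- (star z * z))"
    unfolding zz qhq using a(2) q aq by (intro nonneg_conjugate_commuting)
  obtain \<alpha> \<beta> where \<alpha>\<beta>: "star \<alpha> = \<alpha>" "star \<beta> = \<beta>" "z = \<alpha> + \<i> *\<^sub>C \<beta>"
    using real_imaginary_decomposition[of z] by metis
  have "star z * z + z * star z = 2 *\<^sub>R (\<alpha> * \<alpha>) + 2 *\<^sub>R (\<beta> * \<beta>)"
    using \<alpha>\<beta> by (simp add: star_scaleC algebra_simps mult_scaleC_left mult_scaleC_right scaleC_scaleC scaleR_2)
  then have "z * star z = 2 *\<^sub>R (\<alpha> * \<alpha>) + 2 *\<^sub>R (\<beta> * \<beta>) + - (star z * z)"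
    by (simp add: algebra_simps eq_diff_eq)
  moreover have "nonneg (2 *\<^sub>R (\<alpha> * \<alpha>) + 2 *\<^sub>R (\<beta> * \<beta>) + - (star z * z))"
    using \<alpha>\<beta>(1,2) by (intro nonneg_add k nonneg_scaleR nonneg_selfadjoint_square) auto
  ultimately have "nonneg (z * star z)" by metis
  then have "z = 0" by (rule nonneg_intertwiner_zero[OF k])
  then have qaq: "q * a * q = 0" and "q * h * q = 0" using zz qhq by auto
  moreover have "q * q * q = q * a * q - q * h * q" by (simp add: q_def algebra_simps)
  ultimately have "q * q * q = 0" by simp
  then have "(q * q) * (q * q) = 0" by (metis mult.assoc mult_zero_right)
  then have "q = 0" using norm_selfadjoint_square[of q] norm_selfadjoint_square[of "q * q"] q by auto
  then show ?thesis using a(2) by (simp add: q_def h_def)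
qed

lemma nonneg_mult_star: "nonneg (y * star (y::'a::cstar_algebra))"
  using nonneg_star_mult[of "star y"] by simp

lemma nonneg_iff_positive_in:
  assumes "cstar_subalgebra C" "1 \<in> C"
  shows "positive_in C x \<longleftrightarrow> nonneg x \<and> x \<in> C"
proof
  assume "positive_in C x"
  then show "nonneg x \<and> x \<in> C"
    unfolding positive_in_def using nonneg_star_mult cstar_subalgebra_closed[OF assms(1)] by auto
next
  assume x: "nonneg x \<and> x \<in> C"
  then obtain s where s: "s * s = x" "nonneg s" "s \<in> C"
    using nonneg_sqrt[of x] assms by metis
  then show "positive_in C x"
    unfolding positive_in_def by (metis nonneg_star)
qed

lemma cstar_subalgebra_UNIV: "cstar_subalgebra (UNIV :: 'a::cstar_algebra set)"
  by (simp add: cstar_subalgebra_def)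

lemma nonneg_iff_positive_in_UNIV: "positive_in UNIV x \<longleftrightarrow> nonneg x"
  by (simp add: nonneg_iff_positive_in cstar_subalgebra_UNIV)

lemma nonneg_conjugate:
  assumes "nonneg h" shows "nonneg (x * h * star x)"
proof -
  obtain s where s: "s * s = h" "nonneg s" using nonneg_sqrt[OF assms] by metis
  then have "x * h * star x = (x * s) * star (x * s)" by (auto simp: nonneg_star mult.assoc)
  then show ?thesis by (metis nonneg_mult_star)
qed

section \<open>Bimodule maps and conditional expectations\<close>

text \<open>
  Homogeneity for complex scalars is not listed: for \<open>1 \<in> C\<close> it is the case \<open>c *\<^sub>C 1 \<in> C\<close> of the
  module property.
\<close>

definition bimodule_maps :: "'b::cstar_algebra set \<Rightarrow> ('b \<Rightarrow> 'b) set" where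
  "bimodule_maps C = {T. (\<forall>x y. T (x + y) = T x + T y) \<and>
     (\<forall>c\<in>C. \<forall>x. T (c * x) = c * T x \<and> T (x * c) = T x * c)}"

lemma bimodule_mapsI:
  assumes "\<And>x y. T (x + y) = T x + T y" "\<And>c x. c \<in> C \<Longrightarrow> T (c * x) = c * T x"
    "\<And>c x. c \<in> C \<Longrightarrow> T (x * c) = T x * c"
  shows "T \<in> bimodule_maps C"
  using assms by (simp add: bimodule_maps_def)

lemma bimodule_maps_antimono: "C \<subseteq> D \<Longrightarrow> bimodule_maps D \<subseteq> bimodule_maps C"
  unfolding bimodule_maps_def by blast

lemma bimodule_maps_comp: "S \<in> bimodule_maps C \<Longrightarrow> T \<in> bimodule_maps C \<Longrightarrow> S \<circ> T \<in> bimodule_maps C"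
  unfolding bimodule_maps_def by simp

lemma bimodule_map_simps:
  assumes "T \<in> bimodule_maps C"
  shows "T (x + y) = T x + T y" "c \<in> C \<Longrightarrow> T (c * x) = c * T x" "c \<in> C \<Longrightarrow> T (x * c) = T x * c"
    "T 0 = 0" "T (x - y) = T x - T y" "T (\<Sum>i\<in>I. f i) = (\<Sum>i\<in>I. T (f i))"
proof -
  show add: "T (x + y) = T x + T y" for x y using assms by (simp add: bimodule_maps_def)
  show "c \<in> C \<Longrightarrow> T (c * x) = c * T x" "c \<in> C \<Longrightarrow> T (x * c) = T x * c"
    using assms by (simp_all add: bimodule_maps_def)
  interpret Modules.additive T by unfold_locales (rule add)
  show "T 0 = 0" "T (x - y) = T x - T y" "T (\<Sum>i\<in>I. f i) = (\<Sum>i\<in>I. T (f i))"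
    by (rule zero diff sum)+
qed

lemma scaleC_one_in: "cstar_subalgebra C \<Longrightarrow> 1 \<in> C \<Longrightarrow> c *\<^sub>C 1 \<in> C"
  unfolding cstar_subalgebra_def by (auto intro: complex_vector.subspace_scale)

lemma bimodule_map_scaleC:
  assumes "T \<in> bimodule_maps C" "cstar_subalgebra C" "1 \<in> C"
  shows "T (c *\<^sub>C x) = c *\<^sub>C T x"
  using bimodule_map_simps(2)[OF assms(1) scaleC_one_in[OF assms(2,3)]]
  by (simp add: mult_scaleC_left)

lemma bimodule_map_scaleR:
  assumes "T \<in> bimodule_maps C" "cstar_subalgebra C" "1 \<in> C"
  shows "T (r *\<^sub>R x) = r *\<^sub>R T x"
  using bimodule_map_scaleC[OF assms, of "complex_of_real r"] by (simp add: scaleC_of_real)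

lemma conditional_expectation_iff:
  assumes "cstar_subalgebra C" "1 \<in> C"
  shows "conditional_expectation C F \<longleftrightarrow>
    F \<in> bimodule_maps C \<and> range F \<subseteq> C \<and> (\<forall>c\<in>C. F c = c) \<and> (\<forall>x. nonneg x \<longrightarrow> nonneg (F x))"
    (is "?L \<longleftrightarrow> ?R")
proof
  assume L: ?L
  then have lin: "Vector_Spaces.linear scaleC scaleC F"
    and mult: "\<And>c d x. c \<in> C \<Longrightarrow> d \<in> C \<Longrightarrow> F (c * x * d) = c * F x * d"
    unfolding conditional_expectation_def by blast+
  have "F \<in> bimodule_maps C"
    using mult[OF _ assms(2)] mult[OF assms(2)] Vector_Spaces.linear_iff[THEN iffD1, OF lin]
    by (intro bimodule_mapsI) auto
  with L show ?R
    unfolding conditional_expectation_def nonneg_iff_positive_in[OF assms] nonneg_iff_positive_in_UNIV by blast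
next
  assume R: ?R
  note simps = bimodule_map_simps[of F C] 
  have "Vector_Spaces.linear scaleC scaleC F"
    using R simps bimodule_map_scaleC[OF _ assms, of F]
    by (auto simp: Vector_Spaces.linear_iff complex_vector.vector_space_axioms)
  moreover have "F (c * x * d) = c * F x * d" if "c \<in> C" "d \<in> C" for c d x
    using R that by (simp add: simps(2,3))
  moreover have "F x \<in> C" for x using R by blast
  ultimately show ?L
    using R unfolding conditional_expectation_def nonneg_iff_positive_in[OF assms]
      nonneg_iff_positive_in_UNIV by simp
qed

text \<open>
  A self-adjoint \<open>h\<close> is the difference of the positive elements \<open>norm h\<close> and \<open>norm h - h\<close>, so
  a positive map preserves self-adjointness.
\<close>

lemma nonneg_bimodule_map_star:
  assumes "cstar_subalgebra C" "1 \<in> C" "T \<in> bimodule_maps C" "\<And>x. nonneg x \<Longrightarrow> nonneg (T x)"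
  shows "T (star x) = star (T x)"
proof -
  note simps = bimodule_map_simps[OF assms(3)] bimodule_map_scaleC[OF assms(3,1,2)]
    bimodule_map_scaleR[OF assms(3,1,2)]
  have sa: "star (T h) = T h" if "star h = h" for h
  proof -
    have "nonneg (T (norm h *\<^sub>R 1))" by (intro assms(4) nonneg_scaleR_one norm_ge_zero)
    moreover have "nonneg (T (norm h *\<^sub>R 1 - h))"
      by (rule assms(4)[OF nonneg_norm_minus[OF that order_refl]])
    ultimately have "star (T (norm h *\<^sub>R 1) - T (norm h *\<^sub>R 1 - h)) = T (norm h *\<^sub>R 1) - T (norm h *\<^sub>R 1 - h)"
      by (simp add: nonneg_star)
    then show ?thesis by (simp add: simps)
  qed
  obtain a b where "star a = a" "star b = b" "x = a + \<i> *\<^sub>C b"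
    using real_imaginary_decomposition[of x] by metis
  then show ?thesis by (simp add: simps star_scaleC sa)
qed

text \<open>
  Apply \<open>F\<close> to the positive element \<open>star (x - F x) * (x - F x)\<close>.
\<close>

lemma conditional_expectation_schwarz:
  assumes "cstar_subalgebra C" "1 \<in> C" "conditional_expectation C F"
  shows "nonneg (F (star x * x) - star (F x) * F x)"
proof -
  have F: "F \<in> bimodule_maps C" "\<And>x. F x \<in> C" "\<And>c. c \<in> C \<Longrightarrow> F c = c" "\<And>x. nonneg x \<Longrightarrow> nonneg (F x)"
    using assms(3) unfolding conditional_expectation_iff[OF assms(1,2)] by auto
  note simps = bimodule_map_simps[OF F(1)]
  have Fs: "F (star x) = star (F x)" for x
    by (rule nonneg_bimodule_map_star[OF assms(1,2) F(1,4)])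
  have sC: "star (F x) \<in> C" using F(2) cstar_subalgebra_closed(4)[OF assms(1)] by simp
  have "star (x - F x) * (x - F x)
      = star x * x - star x * F x - star (F x) * x + star (F x) * F x"
    by (simp add: left_diff_distrib right_diff_distrib)
  moreover have "F (star x * F x) = star (F x) * F x" using simps(3)[OF F(2)] by (simp add: Fs)
  moreover have "F (star (F x) * x) = star (F x) * F x" using simps(2)[OF sC] by simp
  moreover have "F (star (F x) * F x) = star (F x) * F x"
    by (rule F(3)[OF cstar_subalgebra_closed(3)[OF assms(1) sC F(2)]])
  ultimately have "F (star (x - F x) * (x - F x)) = F (star x * x) - star (F x) * F x"
    by (simp only: simps(1,5)) simp
  then show ?thesis using F(4)[OF nonneg_star_mult[of "x - F x"]] by simp
qed

lemma conditional_expectation_norm_le: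
  assumes "cstar_subalgebra C" "1 \<in> C" "conditional_expectation C F"
  shows "norm (F x) \<le> norm x"
proof -
  have F: "F \<in> bimodule_maps C" "F 1 = 1" "\<And>x. nonneg x \<Longrightarrow> nonneg (F x)"
    using assms(2,3) unfolding conditional_expectation_iff[OF assms(1,2)] by auto
  have "nonneg ((norm x)\<^sup>2 *\<^sub>R 1 - star x * x)"
    by (rule nonneg_norm_minus) (simp_all add: cstar_identity)
  from F(3)[OF this] have upper: "nonneg ((norm x)\<^sup>2 *\<^sub>R 1 - F (star x * x))"
    by (simp only: bimodule_map_simps(5)[OF F(1)] bimodule_map_scaleR[OF F(1) assms(1,2)] F(2))
  have "nonneg ((norm x)\<^sup>2 *\<^sub>R 1 - star (F x) * F x)"
  proof -
    have "(p - q) + (r - p) = r - q" for p q r :: 'a by simp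
    then show ?thesis
      using nonneg_add[OF conditional_expectation_schwarz[OF assms, of x] upper] by (simp only:)
  qed
  then have "norm (star (F x) * F x) \<le> (norm x)\<^sup>2"
    by (rule norm_le_of_nonneg[OF nonneg_star_mult]) simp
  then show ?thesis unfolding cstar_identity by (rule power2_le_imp_le) simp
qed

lemma one_dimensional_scalars:
  assumes "complex_vector.dim V = 1" "1 \<in> V" "x \<in> V"
  shows "\<exists>c. x = c *\<^sub>C (1::'a::cstar_algebra)"
proof -
  obtain B where B: "B \<subseteq> V" "V \<subseteq> complex_vector.span B" "card B = 1"
    using complex_vector.basis_exists[of V] assms(1) by metis
  then obtain v where "B = {v}" by (auto simp: card_Suc_eq One_nat_def)
  then have span: "\<And>y. y \<in> V \<Longrightarrow> \<exists>k. y = k *\<^sub>C v"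
    using B(2) complex_vector.span_breakdown_eq[of _ v "{}"] by auto
  obtain k l where k: "1 = k *\<^sub>C v" and l: "x = l *\<^sub>C v" using span assms(2,3) by blast
  have "k \<noteq> 0" using k by auto
  then have "x = (l / k) *\<^sub>C 1" unfolding k l scaleC_scaleC by simp
  then show ?thesis ..
qed

section \<open>The space of bimodule maps of an irreducible inclusion\<close>

text \<open>
  The hypotheses of the theorem with one quasi-basis fixed, so that estimates uniform in the
  intermediate algebra can be expressed through its norms.
\<close>

locale irreducible_finite_index =
  fixes A :: "'b::cstar_algebra set" and E :: "'b \<Rightarrow> 'b" and n :: nat and u :: "nat \<Rightarrow> 'b"
  assumes subalgebra: "cstar_subalgebra A" and one_in: "1 \<in> A"
    and expectation: "conditional_expectation A E" and faithful: "faithful E"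
    and quasi_basis: "finite_quasi_basis E n u"
    and irreducible: "irreducible_inclusion A"
begin

lemmas E_facts = expectation[unfolded conditional_expectation_iff[OF subalgebra one_in]]

lemma E_bimodule: "E \<in> bimodule_maps A" and E_in [simp]: "E x \<in> A"
  and E_on: "a \<in> A \<Longrightarrow> E a = a" and E_nonneg: "nonneg x \<Longrightarrow> nonneg (E x)"
  using E_facts by auto

lemmas E_simps = bimodule_map_simps[OF E_bimodule]

lemma E_star: "E (star x) = star (E x)"
  by (rule nonneg_bimodule_map_star[OF subalgebra one_in E_bimodule E_nonneg])

lemma E_norm_le: "norm (E x) \<le> norm x"
  by (rule conditional_expectation_norm_le[OF subalgebra one_in expectation])

lemma E_tendsto:
  assumes "f \<longlonglongrightarrow> x" shows "(\<lambda>s. E (f s)) \<longlonglongrightarrow> E x"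
proof -
  have "bounded_linear E"
    by (rule bounded_linear_intro[of _ 1])
       (auto simp: E_simps bimodule_map_scaleR[OF E_bimodule subalgebra one_in] E_norm_le)
  then show ?thesis using assms by (rule bounded_linear.tendsto)
qed

lemma reconstruct: "(\<Sum>k<n. u k * E (star (u k) * x)) = x"
  using quasi_basis unfolding finite_quasi_basis_def by metis

lemma reconstruct': "(\<Sum>k<n. E (x * u k) * star (u k)) = x"
proof -
  have "star (\<Sum>k<n. u k * E (star (u k) * star x)) = x" by (simp only: reconstruct star_star)
  then show ?thesis by (simp add: star_sum E_star[symmetric])
qed

lemma E_nondegenerate:
  assumes "\<And>y. E (star x * y) = E (star x' * y)" shows "x = x'"
proof -
  have "E (star (x - x') * (x - x')) = 0"
    using assms[of "x - x'"] by (simp add: left_diff_distrib E_simps)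
  then have "star (x - x') * (x - x') = 0"
    using faithful unfolding faithful_def nonneg_iff_positive_in_UNIV using nonneg_star_mult by blast
  then show ?thesis using cstar_identity[of "x - x'"] by simp
qed

lemma commuting_scalar:
  assumes "\<And>a. a \<in> A \<Longrightarrow> a * x = x * a" shows "\<exists>c. x = c *\<^sub>C 1"
  using irreducible assms unfolding irreducible_inclusion_def
  by (intro one_dimensional_scalars[of "relative_commutant A"]) (auto simp: relative_commutant_def)

abbreviation M :: "('b \<Rightarrow> 'b) set" where "M \<equiv> bimodule_maps A"

lemma bimodule_map_expand:
  assumes "T \<in> M" shows "T x = (\<Sum>k<n. T (u k) * E (star (u k) * x))"
proof -
  have "T x = T (\<Sum>k<n. u k * E (star (u k) * x))" by (simp only: reconstruct)
  then show ?thesis by (simp add: bimodule_map_simps[OF assms])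
qed

text \<open>
  The adjoint with respect to the \<open>A\<close>-valued inner product \<open>E (star x * y)\<close>; the formula is what
  the quasi-basis expansion of an adjoint must be, and \<open>E_adj\<close> confirms it.
\<close>

definition adj :: "('b \<Rightarrow> 'b) \<Rightarrow> 'b \<Rightarrow> 'b" where
  "adj T x = (\<Sum>k<n. u k * E (star (T (u k)) * x))"

lemma E_adj:
  assumes "T \<in> M" shows "E (star (adj T x) * y) = E (star x * T y)"
proof -
  have "star (adj T x) * y = (\<Sum>k<n. E (star x * T (u k)) * (star (u k) * y))"
    by (simp add: adj_def star_sum sum_distrib_right E_star[symmetric] mult.assoc)
  then have "E (star (adj T x) * y) = (\<Sum>k<n. E (star x * T (u k)) * E (star (u k) * y))"
    by (simp add: E_simps)
  also have "\<dots> = E (star x * T y)"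
    by (subst bimodule_map_expand[OF assms, of y])
       (simp add: E_simps sum_distrib_left mult.assoc[symmetric])
  finally show ?thesis .
qed

lemma adj_unique:
  assumes "T \<in> M" "\<And>x y. E (star (S x) * y) = E (star x * T y)"
  shows "S = adj T"
proof
  fix x show "S x = adj T x"
    by (rule E_nondegenerate) (simp only: assms(2) E_adj[OF assms(1)])
qed

lemma adj_bimodule:
  assumes "T \<in> M" shows "adj T \<in> M"
proof (rule bimodule_mapsI)
  show "adj T (x + y) = adj T x + adj T y" for x y
    by (simp add: adj_def E_simps distrib_left sum.distrib)
  fix c x assume c: "c \<in> A"
  then have sc: "star c \<in> A" using cstar_subalgebra_closed(4)[OF subalgebra] by simp
  show "adj T (x * c) = adj T x * c"
    using c by (simp add: adj_def E_simps sum_distrib_right mult.assoc[symmetric])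
  show "adj T (c * x) = c * adj T x"
  proof (rule E_nondegenerate)
    fix y
    have "E (star (adj T (c * x)) * y) = E (star x * T (star c * y))"
      using sc by (simp add: E_adj[OF assms] bimodule_map_simps[OF assms] mult.assoc)
    also have "\<dots> = E (star (c * adj T x) * y)"
      by (simp add: E_adj[OF assms, symmetric] mult.assoc)
    finally show "E (star (adj T (c * x)) * y) = E (star (c * adj T x) * y)" .
  qed
qed

lemma E_adj': "T \<in> M \<Longrightarrow> E (star x * adj T y) = E (star (T x) * y)"
  using arg_cong[OF E_adj[of T y x], of star] by (simp add: E_star[symmetric])

lemma adj_adj: "T \<in> M \<Longrightarrow> adj (adj T) = T"
  by (rule adj_unique[symmetric]) (auto simp: adj_bimodule E_adj')

lemma adj_comp: "S \<in> M \<Longrightarrow> T \<in> M \<Longrightarrow> adj (S \<circ> T) = adj T \<circ> adj S"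
  by (rule adj_unique[symmetric]) (auto simp: bimodule_maps_comp E_adj)

text \<open>
  In \<open>B \<otimes>\<^sub>A B\<close> the element \<open>\<Sum>k. u k \<otimes> star (u k)\<close> is central: multiplying it by \<open>x\<close> on the left
  or on the right gives the same result. This is the image of that identity under \<open>S\<close> on the left
  factor and \<open>star \<circ> T \<circ> star\<close> on the right one, obtained by expanding \<open>x * u k\<close> in the quasi-basis.
\<close>

lemma sum_mult_star_eq:
  assumes "S \<in> M" "T \<in> M"
  shows "(\<Sum>k<n. S (x * u k) * star (T (u k))) = (\<Sum>k<n. S (u k) * star (T (star x * u k)))"
proof -
  have "(\<Sum>k<n. S (x * u k) * star (T (u k)))
      = (\<Sum>k<n. \<Sum>j<n. S (u j) * E (star (u j) * x * u k) * star (T (u k)))"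
    by (subst bimodule_map_expand[OF assms(1)]) (simp add: sum_distrib_right mult.assoc)
  also have "\<dots> = (\<Sum>j<n. \<Sum>k<n. S (u j) * E (star (u j) * x * u k) * star (T (u k)))"
    by (rule sum.swap)
  also have "\<dots> = (\<Sum>j<n. S (u j) * star (\<Sum>k<n. T (u k) * E (star (u k) * (star x * u j))))"
    by (simp add: star_sum sum_distrib_left E_star[symmetric] mult.assoc)
  also have "\<dots> = (\<Sum>k<n. S (u k) * star (T (star x * u k)))"
    by (simp only: bimodule_map_expand[OF assms(2), symmetric])
  finally show ?thesis .
qed

text \<open>
  By the centrality above the sum commutes with \<open>A\<close>, so irreducibility makes it a number. It is a
  scalar-valued inner product of \<open>S\<close> and \<open>T\<close>.
\<close>

lemma sum_mult_star_scalar: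
  assumes "S \<in> M" "T \<in> M"
  shows "\<exists>c. (\<Sum>k<n. S (u k) * star (T (u k))) = c *\<^sub>C 1"
proof (rule commuting_scalar)
  fix a assume a: "a \<in> A"
  then have "star a \<in> A" using cstar_subalgebra_closed(4)[OF subalgebra] by simp
  then show "a * (\<Sum>k<n. S (u k) * star (T (u k))) = (\<Sum>k<n. S (u k) * star (T (u k))) * a"
    using sum_mult_star_eq[OF assms, of a] a assms
    by (simp add: bimodule_map_simps[of _ A] sum_distrib_left sum_distrib_right mult.assoc)
qed

lemma sum_adj_eq:
  assumes "S \<in> M" "T \<in> M"
  shows "(\<Sum>k<n. S (adj T (u k)) * star (u k)) = (\<Sum>k<n. S (u k) * star (T (u k)))"
proof -
  have "(\<Sum>k<n. S (adj T (u k)) * star (u k))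
      = (\<Sum>k<n. \<Sum>j<n. S (u j) * (E (star (T (u j)) * u k) * star (u k)))"
    unfolding adj_def by (simp add: bimodule_map_simps[OF assms(1)] sum_distrib_right mult.assoc)
  also have "\<dots> = (\<Sum>j<n. \<Sum>k<n. S (u j) * (E (star (T (u j)) * u k) * star (u k)))"
    by (rule sum.swap)
  also have "\<dots> = (\<Sum>j<n. S (u j) * star (T (u j)))"
    by (simp only: sum_distrib_left[symmetric] reconstruct')
  finally show ?thesis .
qed

end

section \<open>Finite dimension of the space of bimodule maps\<close>

lemma norm_mono_of_diff:
  assumes "nonneg a" "nonneg (b - a)" shows "norm a \<le> norm b"
  using norm_mono_nonneg[OF assms] by simp

text \<open>
  The difference is a sum of terms \<open>(f j - f k) * star (f j - f k)\<close> over pairs \<open>j < k\<close>; the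
  induction adds the pairs with \<open>k = m\<close>.
\<close>

lemma nonneg_cauchy_schwarz:
  fixes f :: "nat \<Rightarrow> 'a::cstar_algebra"
  shows "nonneg (real m *\<^sub>R (\<Sum>k<m. f k * star (f k)) - (\<Sum>k<m. f k) * star (\<Sum>k<m. f k))"
proof (induction m)
  case (Suc m)
  let ?s = "\<Sum>k<m. f k" and ?q = "\<Sum>k<m. f k * star (f k)" and ?x = "f m"
  have "(\<Sum>k<m. (f k - ?x) * star (f k - ?x))
      = ?q - ?s * star ?x - ?x * star ?s + real m *\<^sub>R (?x * star ?x)"
    by (simp add: left_diff_distrib right_diff_distrib sum_subtractf sum_distrib_left[symmetric]
        sum_distrib_right[symmetric] star_sum sum_constant_scaleR algebra_simps sum.distrib del: sum_constant)
  moreover have "nonneg (\<Sum>k<m. (f k - ?x) * star (f k - ?x))"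
    by (intro nonneg_sum nonneg_mult_star)
  ultimately have "nonneg (?q - ?s * star ?x - ?x * star ?s + real m *\<^sub>R (?x * star ?x))" by simp
  from nonneg_add[OF Suc this]
  have "nonneg ((real m *\<^sub>R ?q - ?s * star ?s) + (?q - ?s * star ?x - ?x * star ?s + real m *\<^sub>R (?x * star ?x)))" .
  also have "(real m *\<^sub>R ?q - ?s * star ?s) + (?q - ?s * star ?x - ?x * star ?s + real m *\<^sub>R (?x * star ?x))
    = real (Suc m) *\<^sub>R (\<Sum>k<Suc m. f k * star (f k)) - (\<Sum>k<Suc m. f k) * star (\<Sum>k<Suc m. f k)"
    by (simp add: algebra_simps)
  finally show ?case .
qed simp

lemma nonneg_scalar:
  assumes "nonneg (c *\<^sub>C (1::'a::cstar_algebra))"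
  shows "c *\<^sub>C (1::'a) = norm (c *\<^sub>C (1::'a)) *\<^sub>R 1"
proof -
  have "(cnj c - c) *\<^sub>C (1::'a) = 0"
    using nonneg_star[OF assms] by (simp add: star_scaleC complex_vector.scale_left_diff_distrib)
  then have "cnj c = c" by simp
  then obtain r where r: "c = complex_of_real r" by (metis Reals_cnj_iff Reals_cases)
  have "r \<ge> 0"
  proof (rule ccontr)
    assume "\<not> r \<ge> 0"
    then have "nonneg (- (c *\<^sub>C (1::'a)))"
      using nonneg_scaleR_one[of "- r", where ?'a='a] by (simp add: r scaleC_of_real)
    then have "c *\<^sub>C (1::'a) = 0" using assms by (intro nonneg_antisym)
    then show False using \<open>\<not> r \<ge> 0\<close> r by auto
  qed
  then show ?thesis by (simp add: r scaleC_of_real)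
qed

lemma bounded_complex_families_subsequence:
  fixes c :: "nat \<Rightarrow> nat \<Rightarrow> complex"
  assumes "\<And>s i. i < m \<Longrightarrow> cmod (c s i) \<le> K"
  shows "\<exists>r l. strict_mono (r :: nat \<Rightarrow> nat) \<and> (\<forall>i<m. (\<lambda>s. c (r s) i) \<longlonglongrightarrow> l i)"
  using assms
proof (induction m)
  case 0
  show ?case by (rule exI[of _ id]) (simp add: strict_mono_def)
next
  case (Suc m)
  then obtain r l where r: "strict_mono (r :: nat \<Rightarrow> nat)" and l: "\<And>i. i < m \<Longrightarrow> (\<lambda>s. c (r s) i) \<longlonglongrightarrow> l i"
    by (metis less_Suc_eq)
  have "bounded (range (\<lambda>s. c (r s) m))"
    using Suc.prems by (auto simp: bounded_iff)
  then obtain a q where q: "strict_mono (q :: nat \<Rightarrow> nat)" and a: "((\<lambda>s. c (r s) m) \<circ> q) \<longlonglongrightarrow> a"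
    using bounded_imp_convergent_subsequence by blast
  have "(\<lambda>s. c ((r \<circ> q) s) i) \<longlonglongrightarrow> (l(m := a)) i" if "i < Suc m" for i
  proof (cases "i = m")
    case False
    then have "((\<lambda>s. c (r s) i) \<circ> q) \<longlonglongrightarrow> l i"
      using that by (intro LIMSEQ_subseq_LIMSEQ l q) auto
    then show ?thesis using False by (simp add: o_def)
  qed (use a in \<open>simp add: o_def\<close>)
  then show ?case using strict_mono_o[OF r q] by blast
qed

context irreducible_finite_index
begin

text \<open>
  The squared Hilbert--Schmidt norm belonging to the inner product of \<open>sum_mult_star_scalar\<close>. For
  the expectation onto an intermediate algebra \<open>C\<close> it is the Watatani index of \<open>C\<close> over \<open>A\<close>.
\<close>

definition hs_square :: "('b \<Rightarrow> 'b) \<Rightarrow> real" where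
  "hs_square T = norm (\<Sum>k<n. T (u k) * star (T (u k)))"

lemma hs_square_eq:
  assumes "T \<in> M" shows "(\<Sum>k<n. T (u k) * star (T (u k))) = hs_square T *\<^sub>R 1"
proof -
  obtain c where c: "(\<Sum>k<n. T (u k) * star (T (u k))) = c *\<^sub>C 1"
    using sum_mult_star_scalar[OF assms assms] by blast
  have "nonneg (\<Sum>k<n. T (u k) * star (T (u k)))" by (intro nonneg_sum nonneg_mult_star)
  then show ?thesis unfolding hs_square_def c by (rule nonneg_scalar)
qed

lemma norm_le_sum_squares:
  fixes f :: "nat \<Rightarrow> 'b"
  assumes "k < n" shows "(norm (f k))\<^sup>2 \<le> norm (\<Sum>k<n. f k * star (f k))"
proof -
  have "(\<Sum>k<n. f k * star (f k)) = f k * star (f k) + (\<Sum>j\<in>{..<n}-{k}. f j * star (f j))"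
    using assms by (intro sum.remove) auto
  moreover have "norm (f k * star (f k)) \<le> norm (f k * star (f k) + (\<Sum>j\<in>{..<n}-{k}. f j * star (f j)))"
    by (intro norm_mono_nonneg nonneg_sum nonneg_mult_star)
  ultimately show ?thesis by (simp add: norm_mult_star)
qed

lemma norm_le_hs_square: "k < n \<Longrightarrow> (norm (T (u k)))\<^sup>2 \<le> hs_square T"
  unfolding hs_square_def by (rule norm_le_sum_squares)

lemma hs_square_eq_0:
  assumes "T \<in> M" "hs_square T = 0" shows "T x = 0"
proof -
  have "T (u k) = 0" if "k < n" for k using norm_le_hs_square[OF that, of T] assms(2) by simp
  then show ?thesis by (subst bimodule_map_expand[OF assms(1)]) simp
qed

definition orthonormal :: "nat \<Rightarrow> (nat \<Rightarrow> 'b \<Rightarrow> 'b) \<Rightarrow> bool" where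
  "orthonormal m T \<longleftrightarrow> (\<forall>i<m. T i \<in> M) \<and>
     (\<forall>i<m. \<forall>j<m. (\<Sum>k<n. T i (u k) * star (T j (u k))) = (if i = j then 1 else 0))"

text \<open>
  Bessel's inequality with coefficients in \<open>B\<close>. Combine the given maps with the coefficients
  \<open>star (T i (u l))\<close> to a row \<open>R\<close>. Orthonormality gives \<open>\<Sum>j. R j * star (R j) = w\<close>, where \<open>w\<close> is
  the sum to be estimated, and the entry \<open>R l\<close> is \<open>w\<close> itself. Hence \<open>w\<^sup>2 \<le> w\<close>.
\<close>

lemma bessel:
  assumes T: "orthonormal m T" and l: "l < n"
  shows "norm (\<Sum>i<m. star (T i (u l)) * T i (u l)) \<le> 1"
proof -
  define v where "v i = T i (u l)" for i
  define w where "w = (\<Sum>i<m. star (v i) * v i)"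
  define R where "R j = (\<Sum>i<m. star (v i) * T i (u j))" for j
  have Rl: "R l = w" by (simp add: R_def w_def v_def)
  have "(\<Sum>j<n. R j * star (R j))
      = (\<Sum>j<n. \<Sum>i<m. \<Sum>i'<m. star (v i) * (T i (u j) * star (T i' (u j))) * v i')"
    by (simp add: R_def star_sum sum_product mult.assoc)
  also have "\<dots> = (\<Sum>i<m. \<Sum>j<n. \<Sum>i'<m. star (v i) * (T i (u j) * star (T i' (u j))) * v i')"
    by (rule sum.swap)
  also have "\<dots> = (\<Sum>i<m. \<Sum>i'<m. \<Sum>j<n. star (v i) * (T i (u j) * star (T i' (u j))) * v i')"
    by (intro sum.cong refl sum.swap)
  also have "\<dots> = (\<Sum>i<m. \<Sum>i'<m. star (v i) * (\<Sum>j<n. T i (u j) * star (T i' (u j))) * v i')"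
    by (simp only: sum_distrib_left sum_distrib_right)
  also have "\<dots> = (\<Sum>i<m. \<Sum>i'<m. if i = i' then star (v i) * v i' else 0)"
    using T by (intro sum.cong refl) (auto simp: orthonormal_def)
  also have "\<dots> = w" by (simp add: w_def)
  finally have "(norm w)\<^sup>2 \<le> norm w"
    using norm_le_sum_squares[OF l, of R] Rl by simp
  then have "norm w \<le> 1"
    by (cases "norm w = 0") (auto simp: power2_eq_square)
  then show ?thesis by (simp add: w_def v_def)
qed

lemma E_schwarz: "nonneg (E (y * star y) - E y * star (E y))"
  using conditional_expectation_schwarz[OF subalgebra one_in expectation, of "star y"]
  by (simp add: E_star)

definition square_sum :: real where "square_sum = (\<Sum>k<n. (norm (u k))\<^sup>2)"
definition norm_sum :: real where "norm_sum = (\<Sum>k<n. norm (u k))"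

lemma square_sum_nonneg: "0 \<le> square_sum"
  by (simp add: square_sum_def sum_nonneg)

text \<open>
  Expanding the adjoints in the quasi-basis and applying the Cauchy--Schwarz and Schwarz
  inequalities reduces the sum to those of \<open>bessel\<close>. The point is that the bound does not depend
  on \<open>m\<close>.
\<close>

lemma sum_adj_bound:
  assumes T: "orthonormal m T"
  shows "norm (\<Sum>i<m. adj (T i) x * star (adj (T i) x)) \<le> real n * square_sum * (norm x)\<^sup>2"
proof -
  define e where "e i k = E (star (T i (u k)) * x)" for i k
  have ee: "norm (\<Sum>i<m. e i k * star (e i k)) \<le> (norm x)\<^sup>2" if k: "k < n" for k
  proof -
    define y where "y i = star (T i (u k)) * x" for i
    have "norm (\<Sum>i<m. e i k * star (e i k)) \<le> norm (\<Sum>i<m. E (y i * star (y i)))"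
    proof (rule norm_mono_of_diff)
      show "nonneg (\<Sum>i<m. e i k * star (e i k))" by (intro nonneg_sum nonneg_mult_star)
      show "nonneg ((\<Sum>i<m. E (y i * star (y i))) - (\<Sum>i<m. e i k * star (e i k)))"
        unfolding sum_subtractf[symmetric] e_def y_def by (intro nonneg_sum E_schwarz)
    qed
    also have "\<dots> \<le> norm (\<Sum>i<m. y i * star (y i))"
      unfolding E_simps(6)[symmetric] by (rule E_norm_le)
    also have "\<dots> \<le> norm ((norm x)\<^sup>2 *\<^sub>R (\<Sum>i<m. star (T i (u k)) * T i (u k)))"
    proof (rule norm_mono_of_diff)
      show "nonneg (\<Sum>i<m. y i * star (y i))" by (intro nonneg_sum nonneg_mult_star)
      have "nonneg ((norm x)\<^sup>2 *\<^sub>R 1 - x * star x)"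
        by (rule nonneg_norm_minus) (simp_all add: norm_mult_star)
      then have "nonneg (star (T i (u k)) * ((norm x)\<^sup>2 *\<^sub>R 1 - x * star x) * star (star (T i (u k))))" for i
        by (rule nonneg_conjugate)
      then have "nonneg (\<Sum>i<m. star (T i (u k)) * ((norm x)\<^sup>2 *\<^sub>R 1 - x * star x) * T i (u k))"
        by (intro nonneg_sum) simp
      also have "(\<Sum>i<m. star (T i (u k)) * ((norm x)\<^sup>2 *\<^sub>R 1 - x * star x) * T i (u k))
        = (norm x)\<^sup>2 *\<^sub>R (\<Sum>i<m. star (T i (u k)) * T i (u k)) - (\<Sum>i<m. y i * star (y i))"
        by (simp add: y_def algebra_simps scaleR_sum_right sum_subtractf)
      finally show "nonneg ((norm x)\<^sup>2 *\<^sub>R (\<Sum>i<m. star (T i (u k)) * T i (u k)) - (\<Sum>i<m. y i * star (y i)))" .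
    qed
    also have "\<dots> \<le> (norm x)\<^sup>2" using bessel[OF T k] by (simp add: mult_left_le)
    finally show ?thesis .
  qed
  define z where "z i k = u k * e i k" for i k
  have adj: "adj (T i) x = (\<Sum>k<n. z i k)" for i by (simp add: adj_def z_def e_def)
  have "norm (\<Sum>i<m. adj (T i) x * star (adj (T i) x))
      \<le> norm (\<Sum>i<m. real n *\<^sub>R (\<Sum>k<n. z i k * star (z i k)))"
  proof (rule norm_mono_of_diff)
    show "nonneg (\<Sum>i<m. adj (T i) x * star (adj (T i) x))" by (intro nonneg_sum nonneg_mult_star)
    show "nonneg ((\<Sum>i<m. real n *\<^sub>R (\<Sum>k<n. z i k * star (z i k)))
        - (\<Sum>i<m. adj (T i) x * star (adj (T i) x)))"
      unfolding sum_subtractf[symmetric] adj by (intro nonneg_sum nonneg_cauchy_schwarz)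
  qed
  also have "(\<Sum>i<m. real n *\<^sub>R (\<Sum>k<n. z i k * star (z i k)))
      = real n *\<^sub>R (\<Sum>k<n. u k * (\<Sum>i<m. e i k * star (e i k)) * star (u k))"
    unfolding scaleR_sum_right[symmetric]
    by (subst sum.swap) (simp add: z_def sum_distrib_left sum_distrib_right mult.assoc)
  also have "norm \<dots> \<le> real n * (\<Sum>k<n. (norm (u k))\<^sup>2 * (norm x)\<^sup>2)"
  proof -
    have "norm (u k * (\<Sum>i<m. e i k * star (e i k)) * star (u k)) \<le> (norm (u k))\<^sup>2 * (norm x)\<^sup>2"
      if "k < n" for k
    proof -
      have "norm (u k * (\<Sum>i<m. e i k * star (e i k)) * star (u k))
          \<le> norm (u k) * norm (\<Sum>i<m. e i k * star (e i k)) * norm (star (u k))"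
        by (intro order_trans[OF norm_mult_ineq] mult_right_mono norm_mult_ineq norm_ge_zero)
      also have "\<dots> \<le> norm (u k) * (norm x)\<^sup>2 * norm (star (u k))"
        by (intro mult_right_mono mult_left_mono ee that norm_ge_zero)
      finally show ?thesis by (simp add: power2_eq_square mult_ac)
    qed
    then have "norm (\<Sum>k<n. u k * (\<Sum>i<m. e i k * star (e i k)) * star (u k))
        \<le> (\<Sum>k<n. (norm (u k))\<^sup>2 * (norm x)\<^sup>2)"
      by (intro sum_norm_le) auto
    then show ?thesis by (simp add: mult_left_mono)
  qed
  finally show ?thesis by (simp add: square_sum_def sum_distrib_right mult.assoc)
qed

text \<open>
  Since \<open>T\<close> is the adjoint of \<open>adj T\<close>, the quasi-basis expansion bounds its values by those of
  \<open>adj T\<close>.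
\<close>

lemma hs_square_adj_bound:
  assumes "T \<in> M" shows "hs_square T \<le> square_sum * norm_sum\<^sup>2 * hs_square (adj T)"
proof -
  let ?S = "adj T"
  have T: "norm (T x) \<le> norm_sum * sqrt (hs_square ?S) * norm x" for x
  proof -
    have "T x = (\<Sum>k<n. u k * E (star (?S (u k)) * x))"
      using arg_cong[OF adj_adj[OF assms], of "\<lambda>f. f x"] by (simp add: adj_def[of "adj T"])
    also have "norm \<dots> \<le> (\<Sum>k<n. norm (u k) * (sqrt (hs_square ?S) * norm x))"
    proof (rule sum_norm_le)
      fix k assume "k \<in> {..<n}"
      then have "norm (?S (u k)) \<le> sqrt (hs_square ?S)" using norm_le_hs_square[of k ?S] by (simp add: real_le_rsqrt)
      then show "norm (u k * E (star (?S (u k)) * x)) \<le> norm (u k) * (sqrt (hs_square ?S) * norm x)"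
        by (intro order_trans[OF norm_mult_ineq] mult_left_mono order_trans[OF E_norm_le]
            mult_right_mono) auto
    qed
    finally show ?thesis by (simp add: norm_sum_def sum_distrib_right mult.assoc)
  qed
  have "hs_square T \<le> (\<Sum>k<n. (norm_sum * sqrt (hs_square ?S) * norm (u k))\<^sup>2)"
    unfolding hs_square_def[of T]
    by (intro sum_norm_le) (simp only: norm_mult_star, intro power_mono T norm_ge_zero)
  also have "\<dots> = square_sum * norm_sum\<^sup>2 * hs_square ?S"
    by (simp add: power_mult_distrib square_sum_def sum_distrib_left sum_distrib_right mult_ac hs_square_def)
  finally show ?thesis .
qed

text \<open>
  The adjoints of an orthonormal system have Hilbert--Schmidt norms bounded below by
  \<open>hs_square_adj_bound\<close>, while the sum of their squares is bounded above by \<open>sum_adj_bound\<close>.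
\<close>

lemma orthonormal_bound:
  assumes T: "orthonormal m T" shows "real m \<le> square_sum * norm_sum\<^sup>2 * (real n * square_sum * square_sum)"
proof -
  have TM: "T i \<in> M" if "i < m" for i using T that by (auto simp: orthonormal_def)
  have sqT: "hs_square (T i) = 1" if "i < m" for i using T that by (simp add: hs_square_def orthonormal_def)
  have "(\<Sum>i<m. hs_square (adj (T i))) *\<^sub>R 1 = (\<Sum>i<m. \<Sum>k<n. adj (T i) (u k) * star (adj (T i) (u k)))"
    unfolding scaleR_sum_left by (intro sum.cong refl hs_square_eq[symmetric] adj_bimodule TM) simp
  also have "\<dots> = (\<Sum>k<n. \<Sum>i<m. adj (T i) (u k) * star (adj (T i) (u k)))" by (rule sum.swap)
  also have "norm \<dots> \<le> (\<Sum>k<n. real n * square_sum * (norm (u k))\<^sup>2)"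
    by (intro sum_norm_le sum_adj_bound T)
  also have "\<dots> = real n * square_sum * square_sum" by (simp add: square_sum_def sum_distrib_left)
  finally have *: "(\<Sum>i<m. hs_square (adj (T i))) \<le> real n * square_sum * square_sum"
    by (simp add: hs_square_def sum_nonneg)
  have "real m = (\<Sum>i<m. hs_square (T i))" by (simp add: sqT)
  also have "\<dots> \<le> (\<Sum>i<m. square_sum * norm_sum\<^sup>2 * hs_square (adj (T i)))" by (intro sum_mono hs_square_adj_bound TM) simp
  also have "\<dots> = square_sum * norm_sum\<^sup>2 * (\<Sum>i<m. hs_square (adj (T i)))" by (simp add: sum_distrib_left)
  also have "\<dots> \<le> square_sum * norm_sum\<^sup>2 * (real n * square_sum * square_sum)" by (intro mult_left_mono * mult_nonneg_nonneg square_sum_nonneg) simp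
  finally show ?thesis .
qed

lemma M_add: "S \<in> M \<Longrightarrow> T \<in> M \<Longrightarrow> (\<lambda>x. S x + T x) \<in> M"
  by (rule bimodule_mapsI) (simp_all add: bimodule_map_simps[of _ A] algebra_simps)

lemma M_scaleC: "T \<in> M \<Longrightarrow> (\<lambda>x. c *\<^sub>C T x) \<in> M"
  by (rule bimodule_mapsI)
     (simp_all add: bimodule_map_simps[of _ A] scaleC_add_right mult_scaleC_left mult_scaleC_right)

lemma M_zero: "(\<lambda>x. 0) \<in> M"
  by (rule bimodule_mapsI) simp_all

lemma M_sum: "(\<And>i. i \<in> I \<Longrightarrow> T i \<in> M) \<Longrightarrow> (\<lambda>x. \<Sum>i\<in>I. T i x) \<in> M"
  by (induction I rule: infinite_finite_induct) (auto intro: M_zero M_add)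

lemma M_diff: "S \<in> M \<Longrightarrow> T \<in> M \<Longrightarrow> (\<lambda>x. S x - T x) \<in> M"
  by (rule bimodule_mapsI) (simp_all add: bimodule_map_simps[of _ A] algebra_simps)

text \<open>
  An orthonormal system of maximal length is a basis: a map \<open>S\<close> differing from its orthogonal
  projection would, after normalization of the difference, give a longer system.
\<close>

lemma finite_orthonormal_basis:
  obtains m T where "orthonormal m T"
    "\<And>S. S \<in> M \<Longrightarrow> \<exists>c. (\<forall>i<m. (\<Sum>k<n. S (u k) * star (T i (u k))) = c i *\<^sub>C 1)
        \<and> (\<forall>x. S x = (\<Sum>i<m. c i *\<^sub>C T i x))"
proof -
  let ?P = "\<lambda>m. \<exists>T. orthonormal m T"
  have "?P 0" by (simp add: orthonormal_def)
  moreover have "\<forall>m. ?P m \<longrightarrow> m \<le> nat \<lceil>square_sum * norm_sum\<^sup>2 * (real n * square_sum * square_sum)\<rceil>"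
  proof (intro allI impI)
    fix m assume "?P m"
    then have "real m \<le> square_sum * norm_sum\<^sup>2 * (real n * square_sum * square_sum)" using orthonormal_bound by blast
    then show "m \<le> nat \<lceil>square_sum * norm_sum\<^sup>2 * (real n * square_sum * square_sum)\<rceil>" by linarith
  qed
  ultimately obtain m where m: "?P m" and max: "\<And>m'. ?P m' \<Longrightarrow> m' \<le> m"
    using Nat.ex_has_greatest_nat[of ?P 0] by metis
  obtain T where T: "orthonormal m T" using m ..
  have TM: "T i \<in> M" if "i < m" for i using T that by (auto simp: orthonormal_def)
  show thesis
  proof (rule that[OF T])
    fix S assume S: "S \<in> M"
    then have "\<forall>i. \<exists>c. i < m \<longrightarrow> (\<Sum>k<n. S (u k) * star (T i (u k))) = c *\<^sub>C 1"
      using sum_mult_star_scalar TM by metis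
    then obtain c where c: "\<And>i. i < m \<Longrightarrow> (\<Sum>k<n. S (u k) * star (T i (u k))) = c i *\<^sub>C 1" by metis
    define R where "R x = S x - (\<Sum>i<m. c i *\<^sub>C T i x)" for x
    have R: "R \<in> M" unfolding R_def by (intro M_diff M_sum M_scaleC S TM) simp
    have RT: "(\<Sum>k<n. R (u k) * star (T i (u k))) = 0" if i: "i < m" for i
    proof -
      have "(\<Sum>k<n. (\<Sum>j<m. c j *\<^sub>C T j (u k)) * star (T i (u k)))
          = (\<Sum>k<n. \<Sum>j<m. c j *\<^sub>C (T j (u k) * star (T i (u k))))"
        by (simp add: sum_distrib_right mult_scaleC_left)
      also have "\<dots> = (\<Sum>j<m. \<Sum>k<n. c j *\<^sub>C (T j (u k) * star (T i (u k))))" by (rule sum.swap)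
      also have "\<dots> = (\<Sum>j<m. c j *\<^sub>C (\<Sum>k<n. T j (u k) * star (T i (u k))))"
        by (simp add: complex_vector.scale_sum_right)
      also have "\<dots> = (\<Sum>j<m. if j = i then c j *\<^sub>C 1 else 0)"
        using T i by (intro sum.cong refl) (auto simp: orthonormal_def)
      also have "\<dots> = c i *\<^sub>C 1" using i by simp
      finally show ?thesis using c[OF i] by (simp add: R_def left_diff_distrib sum_subtractf)
    qed
    have "hs_square R = 0"
    proof (rule ccontr)
      assume "hs_square R \<noteq> 0"
      then have pos: "hs_square R > 0" by (simp add: hs_square_def)
      define d where "d = complex_of_real (1 / sqrt (hs_square R))"
      define T' where "T' i = (if i < m then T i else (\<lambda>x. d *\<^sub>C R x))" for i
      have TR: "(\<Sum>k<n. T i (u k) * star (R (u k))) = 0" if "i < m" for i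
        using arg_cong[OF RT[OF that], of star] by (simp add: star_sum)
      have dd: "(\<Sum>k<n. d *\<^sub>C R (u k) * star (d *\<^sub>C R (u k))) = 1"
      proof -
        have "(\<Sum>k<n. d *\<^sub>C R (u k) * star (d *\<^sub>C R (u k)))
            = (1 / sqrt (hs_square R) * (1 / sqrt (hs_square R))) *\<^sub>R (\<Sum>k<n. R (u k) * star (R (u k)))"
          by (simp add: d_def scaleC_of_real scaleR_sum_right del: of_real_divide)
        also have "\<dots> = 1" unfolding hs_square_eq[OF R] using pos by simp
        finally show ?thesis .
      qed
      have "orthonormal (Suc m) T'"
        unfolding orthonormal_def
      proof (intro conjI allI impI)
        fix i assume "i < Suc m"
        then show "T' i \<in> M" using TM M_scaleC[OF R] by (auto simp: T'_def)
      next
        fix i j assume ij: "i < Suc m" "j < Suc m"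
        show "(\<Sum>k<n. T' i (u k) * star (T' j (u k))) = (if i = j then 1 else 0)"
        proof (cases "i < m"; cases "j < m")
          assume "i < m" "j < m"
          then show ?thesis using T by (simp add: T'_def orthonormal_def)
        next
          assume "i < m" "\<not> j < m"
          then show ?thesis using TR[of i]
            by (auto simp: T'_def star_scaleC mult_scaleC_right complex_vector.scale_sum_right[symmetric])
        next
          assume "\<not> i < m" "j < m"
          then show ?thesis using RT[of j]
            by (auto simp: T'_def mult_scaleC_left complex_vector.scale_sum_right[symmetric])
        next
          assume "\<not> i < m" "\<not> j < m"
          then show ?thesis using dd ij by (simp add: T'_def)
        qed
      qed
      then show False using max[of "Suc m"] by auto
    qed
    then have "S x = (\<Sum>i<m. c i *\<^sub>C T i x)" for x using hs_square_eq_0[OF R, of x] by (simp add: R_def)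
    then show "\<exists>c. (\<forall>i<m. (\<Sum>k<n. S (u k) * star (T i (u k))) = c i *\<^sub>C 1)
        \<and> (\<forall>x. S x = (\<Sum>i<m. c i *\<^sub>C T i x))" using c by blast
  qed
qed

lemma bounded_linear_scaleC: "bounded_linear (\<lambda>c. c *\<^sub>C (x::'b))"
proof (rule bounded_linear_intro[of _ "norm x"])
  show "(r *\<^sub>R c) *\<^sub>C x = r *\<^sub>R (c *\<^sub>C x)" for r c
    by (metis scaleC_of_real scaleC_scaleC scaleR_conv_of_real)
qed (simp_all add: scaleC_add_left norm_scaleC)

lemma bounded_bimodule_maps_subsequence:
  assumes M: "\<And>s. S s \<in> M" and bound: "\<And>s k. k < n \<Longrightarrow> norm (S s (u k)) \<le> B"
  shows "\<exists>r S'. strict_mono (r :: nat \<Rightarrow> nat) \<and> S' \<in> M \<and> (\<forall>x. (\<lambda>s. S (r s) x) \<longlonglongrightarrow> S' x)"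
proof (rule finite_orthonormal_basis)
  fix m T assume T: "orthonormal m T" and expand:
    "\<And>S. S \<in> M \<Longrightarrow> \<exists>c. (\<forall>i<m. (\<Sum>k<n. S (u k) * star (T i (u k))) = c i *\<^sub>C 1)
        \<and> (\<forall>x. S x = (\<Sum>i<m. c i *\<^sub>C T i x))"
  have "\<forall>s. \<exists>c. (\<forall>i<m. (\<Sum>k<n. S s (u k) * star (T i (u k))) = c i *\<^sub>C 1)
      \<and> (\<forall>x. S s x = (\<Sum>i<m. c i *\<^sub>C T i x))"
    using expand[OF M] by blast
  from choice[OF this] obtain c where
    c: "\<And>s i. i < m \<Longrightarrow> (\<Sum>k<n. S s (u k) * star (T i (u k))) = c s i *\<^sub>C 1"
    and S: "\<And>s x. S s x = (\<Sum>i<m. c s i *\<^sub>C T i x)"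
    by blast
  have TM: "T i \<in> M" if "i < m" for i using T that by (auto simp: orthonormal_def)
  have "cmod (c s i) \<le> real n * B" if i: "i < m" for s i
  proof -
    have sqT: "hs_square (T i) = 1" using T i by (simp add: hs_square_def orthonormal_def)
    have "cmod (c s i) = norm (\<Sum>k<n. S s (u k) * star (T i (u k)))" unfolding c[OF i] by (simp add: norm_scaleC)
    also have "\<dots> \<le> (\<Sum>k<n. B * 1)"
    proof (rule sum_norm_le)
      fix k assume k: "k \<in> {..<n}"
      then have "(norm (T i (u k)))\<^sup>2 \<le> 1\<^sup>2" using norm_le_hs_square[of k "T i"] sqT by simp
      then have "norm (T i (u k)) \<le> 1" by (rule power2_le_imp_le) simp
      moreover have "0 \<le> B" using order_trans[OF norm_ge_zero bound[of k s]] k by simp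
      ultimately show "norm (S s (u k) * star (T i (u k))) \<le> B * 1"
        using bound[of k s] k by (intro order_trans[OF norm_mult_ineq] mult_mono) auto
    qed
    finally show ?thesis by simp
  qed
  then obtain r l where r: "strict_mono (r :: nat \<Rightarrow> nat)" and l: "\<And>i. i < m \<Longrightarrow> (\<lambda>s. c (r s) i) \<longlonglongrightarrow> l i"
    using bounded_complex_families_subsequence[of m c "real n * B"] by metis
  show ?thesis
  proof (intro exI conjI allI)
    show "strict_mono r" by (rule r)
    show "(\<lambda>x. \<Sum>i<m. l i *\<^sub>C T i x) \<in> M" by (intro M_sum M_scaleC TM) simp
    show "(\<lambda>s. S (r s) x) \<longlonglongrightarrow> (\<Sum>i<m. l i *\<^sub>C T i x)" for x
      unfolding S by (intro tendsto_sum bounded_linear.tendsto[OF bounded_linear_scaleC] l) simp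
  qed
qed

section \<open>Finiteness\<close>

definition expectation_onto :: "'b set \<Rightarrow> ('b \<Rightarrow> 'b) \<Rightarrow> bool" where
  "expectation_onto C F \<longleftrightarrow>
     cstar_subalgebra C \<and> A \<subseteq> C \<and> conditional_expectation C F \<and> E \<circ> F = E"

lemma compatible_intermediate_iff:
  "compatible_intermediate A E C \<longleftrightarrow> (\<exists>F. expectation_onto C F)"
  by (auto simp: compatible_intermediate_def expectation_onto_def)

lemma expectation_onto_facts:
  assumes "expectation_onto C F"
  shows "F \<in> bimodule_maps C" "F \<in> M" "F x \<in> C" "c \<in> C \<Longrightarrow> F c = c"
    "nonneg x \<Longrightarrow> nonneg (F x)" "E (F x) = E x" "F (star x) = star (F x)" "norm (F x) \<le> norm x"
    "cstar_subalgebra C" "A \<subseteq> C" "1 \<in> C"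
proof -
  show C: "cstar_subalgebra C" and AC: "A \<subseteq> C"
    using assms by (auto simp: expectation_onto_def)
  then show 1: "1 \<in> C" using one_in by blast
  have ce: "conditional_expectation C F" and EF: "E \<circ> F = E"
    using assms by (auto simp: expectation_onto_def)
  note F = ce[unfolded conditional_expectation_iff[OF C 1]]
  then show bim: "F \<in> bimodule_maps C" and "F x \<in> C" "c \<in> C \<Longrightarrow> F c = c"
    and nn: "\<And>x. nonneg x \<Longrightarrow> nonneg (F x)"
    by auto
  then show "F \<in> M" using bimodule_maps_antimono[OF AC] by blast
  show "E (F x) = E x" using fun_cong[OF EF, of x] by simp
  show "F (star x) = star (F x)" by (rule nonneg_bimodule_map_star[OF C 1 bim nn])
  show "norm (F x) \<le> norm x" by (rule conditional_expectation_norm_le[OF C 1 ce])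
qed

text \<open>
  The defining relation \<open>E \<circ> F = E\<close> in the form used below: \<open>F\<close> is the orthogonal projection onto
  \<open>C\<close> for the inner product \<open>E (star x * y)\<close>.
\<close>

lemma E_mult_expectation:
  assumes F: "expectation_onto C F" and c: "c \<in> C"
  shows "E (star x * c) = E (star (F x) * c)"
proof -
  have "E (star x * c) = E (F (star x * c))" by (simp only: expectation_onto_facts(6)[OF F])
  also have "F (star x * c) = star (F x) * c"
    using bimodule_map_simps(3)[OF expectation_onto_facts(1)[OF F] c]
    by (simp add: expectation_onto_facts(7)[OF F])
  finally show ?thesis .
qed

lemma adj_expectation:
  assumes F: "expectation_onto C F" shows "adj F = F"
proof (rule adj_unique[symmetric, OF expectation_onto_facts(2)[OF F]])
  fix x y
  have "E (star (F x) * y) = star (E (star y * F x))" by (simp add: E_star[symmetric])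
  also have "\<dots> = star (E (star (F y) * F x))"
    by (rule arg_cong[OF E_mult_expectation[OF F expectation_onto_facts(3)[OF F]]])
  also have "\<dots> = E (star (F x) * F y)" by (simp add: E_star[symmetric])
  also have "\<dots> = E (star x * F y)"
    by (rule E_mult_expectation[OF F expectation_onto_facts(3)[OF F], symmetric])
  finally show "E (star (F x) * y) = E (star x * F y)" .
qed

lemma reconstruct_intermediate:
  assumes F: "expectation_onto C F" and x: "x \<in> C"
  shows "(\<Sum>k<n. F (u k) * E (star (F (u k)) * x)) = x"
proof -
  have "(\<Sum>k<n. F (u k) * E (star (F (u k)) * x)) = (\<Sum>k<n. F (u k) * E (star (u k) * x))"
    by (intro sum.cong refl arg_cong[of _ _ "\<lambda>y. _ * y"] E_mult_expectation[OF F x, symmetric])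
  also have "\<dots> = F x" by (rule bimodule_map_expand[OF expectation_onto_facts(2)[OF F], symmetric])
  finally show ?thesis using expectation_onto_facts(4)[OF F x] by simp
qed

text \<open>
  The elements \<open>F (u k)\<close> are a quasi-basis of \<open>C\<close> over \<open>A\<close>, so \<open>\<Sum>k. F (u k) \<otimes> star (F (u k))\<close> is
  central for multiplication by \<open>C\<close>; apply \<open>T\<close> to the left factor.
\<close>

lemma intermediate_central:
  assumes F: "expectation_onto C F" and T: "T \<in> M" and x: "x \<in> C"
  shows "(\<Sum>k<n. T (x * F (u k)) * star (F (u k))) = (\<Sum>k<n. T (F (u k)) * star (F (u k))) * x"
proof -
  define c where "c k = F (u k)" for k
  have c: "c k \<in> C" for k using expectation_onto_facts(3)[OF F] by (simp add: c_def)
  note closed = cstar_subalgebra_closed(3,4)[OF expectation_onto_facts(9)[OF F]]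
  have rec: "(\<Sum>j<n. c j * E (star (c j) * y)) = y" if "y \<in> C" for y
    unfolding c_def by (rule reconstruct_intermediate[OF F that])
  have Tc: "T (x * c k) = (\<Sum>j<n. T (c j) * E (star (c j) * (x * c k)))" for k
  proof -
    have "T (x * c k) = T (\<Sum>j<n. c j * E (star (c j) * (x * c k)))"
      by (simp only: rec[OF closed(1)[OF x c]])
    then show ?thesis by (simp add: bimodule_map_simps[OF T])
  qed
  have "(\<Sum>k<n. T (x * c k) * star (c k))
      = (\<Sum>k<n. \<Sum>j<n. T (c j) * E (star (c j) * (x * c k)) * star (c k))"
    by (simp only: Tc sum_distrib_right)
  also have "\<dots> = (\<Sum>j<n. \<Sum>k<n. T (c j) * E (star (c j) * (x * c k)) * star (c k))"
    by (rule sum.swap)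
  also have "\<dots> = (\<Sum>j<n. T (c j) * star (\<Sum>k<n. c k * E (star (c k) * (star x * c j))))"
    by (simp add: star_sum sum_distrib_left E_star[symmetric] mult.assoc)
  also have "\<dots> = (\<Sum>j<n. T (c j) * star (star x * c j))"
    by (simp only: rec[OF closed(1)[OF closed(2)[OF x] c]])
  finally show ?thesis by (simp add: c_def sum_distrib_right mult.assoc)
qed

text \<open>
  Expand \<open>1 = F 1\<close> in the quasi-basis of \<open>C\<close>: the index of \<open>C\<close> over \<open>A\<close> cannot be small,
  uniformly in \<open>C\<close>.
\<close>

lemma hs_square_expectation_lower_bound:
  assumes F: "expectation_onto C F" shows "1 \<le> hs_square F * norm_sum\<^sup>2"
proof -
  have "1 = (\<Sum>k<n. F (u k) * E (star (u k) * 1))"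
    using bimodule_map_expand[OF expectation_onto_facts(2)[OF F], of 1]
      expectation_onto_facts(4)[OF F expectation_onto_facts(11)[OF F]] by simp
  then have "1 = norm (\<Sum>k<n. F (u k) * E (star (u k) * 1))" by (metis norm_one)
  also have "\<dots> \<le> (\<Sum>k<n. sqrt (hs_square F) * norm (u k))"
  proof (rule sum_norm_le)
    fix k assume "k \<in> {..<n}"
    then have "norm (F (u k)) \<le> sqrt (hs_square F)" using norm_le_hs_square[of k F] by (simp add: real_le_rsqrt)
    moreover have "norm (E (star (u k) * 1)) \<le> norm (u k)" using E_norm_le[of "star (u k) * 1"] by simp
    ultimately show "norm (F (u k) * E (star (u k) * 1)) \<le> sqrt (hs_square F) * norm (u k)"
      by (intro order_trans[OF norm_mult_ineq] mult_mono) (auto simp: hs_square_def)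
  qed
  also have "\<dots> = sqrt (hs_square F) * norm_sum" by (simp add: norm_sum_def sum_distrib_left)
  finally have "1\<^sup>2 \<le> (sqrt (hs_square F) * norm_sum)\<^sup>2" by (intro power_mono) auto
  then show ?thesis by (simp add: power_mult_distrib hs_square_def)
qed

text \<open>
  Let \<open>c k = F (u k)\<close> and \<open>\<Theta> x = (\<Sum>k. G (x * c k) * star (c k))\<close>, and let \<open>l\<close> be the number
  \<open>\<Theta> 1\<close>. The map \<open>\<Theta>\<close> is multiplication by \<open>l\<close> on \<open>D\<close>, because \<open>G\<close> is \<open>D\<close>-linear, and on \<open>C\<close>, by
  \<open>intermediate_central\<close>; hence also at \<open>y = d - F d\<close>. With \<open>F\<close> in place of \<open>G\<close> the sum at \<open>y\<close>
  vanishes, since \<open>F y = 0\<close>. If \<open>F\<close> and \<open>G\<close> are close, then \<open>l * y\<close> is small relative to \<open>y\<close>, while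
  \<open>l\<close> is close to the index of \<open>C\<close> over \<open>A\<close>. This forces \<open>y = 0\<close>.
\<close>

lemma close_expectations_subset:
  assumes F: "expectation_onto C F" and G: "expectation_onto D G"
    and close: "2 * square_sum * norm_sum\<^sup>2 * (\<Sum>k<n. norm (F (u k) - G (u k)) * norm (u k)) < 1"
  shows "D \<subseteq> C"
proof
  fix d assume d: "d \<in> D"
  note F_facts = expectation_onto_facts[OF F] and G_facts = expectation_onto_facts[OF G]
  define c where "c k = F (u k)" for k
  define \<eta> where "\<eta> = (\<Sum>k<n. norm (F (u k) - G (u k)) * norm (u k))"
  define y where "y = d - F d"
  have c: "c k \<in> C" for k using F_facts(3) by (simp add: c_def)
  have FG: "norm (G z - F z) \<le> \<eta> * norm z" for z
  proof -
    have "G z - F z = (\<Sum>k<n. (G (u k) - F (u k)) * E (star (u k) * z))"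
      by (subst bimodule_map_expand[OF F_facts(2)], subst bimodule_map_expand[OF G_facts(2)])
         (simp add: left_diff_distrib sum_subtractf)
    also have "norm \<dots> \<le> (\<Sum>k<n. norm (F (u k) - G (u k)) * (norm (u k) * norm z))"
    proof (rule sum_norm_le)
      fix k
      have "norm (E (star (u k) * z)) \<le> norm (u k) * norm z"
        using order_trans[OF E_norm_le norm_mult_ineq, of "star (u k)" z] by simp
      then show "norm ((G (u k) - F (u k)) * E (star (u k) * z))
          \<le> norm (F (u k) - G (u k)) * (norm (u k) * norm z)"
        unfolding norm_minus_commute[of "F (u k)"]
        by (intro order_trans[OF norm_mult_ineq] mult_left_mono) auto
    qed
    finally show ?thesis by (simp add: \<eta>_def sum_distrib_right mult.assoc)
  qed
  have sum_bound: "norm (\<Sum>k<n. (G (z * c k) - F (z * c k)) * star (c k)) \<le> \<eta> * square_sum * norm z" for z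
  proof -
    have "norm (\<Sum>k<n. (G (z * c k) - F (z * c k)) * star (c k)) \<le> (\<Sum>k<n. \<eta> * norm z * (norm (u k))\<^sup>2)"
    proof (rule sum_norm_le)
      fix k
      have ck: "norm (c k) \<le> norm (u k)" using F_facts(8) by (simp add: c_def)
      have "0 \<le> \<eta>" by (simp add: \<eta>_def sum_nonneg)
      have "norm (G (z * c k) - F (z * c k)) \<le> \<eta> * (norm z * norm (c k))"
        by (rule order_trans[OF FG mult_left_mono[OF norm_mult_ineq \<open>0 \<le> \<eta>\<close>]])
      also have "\<dots> \<le> \<eta> * (norm z * norm (u k))"
        using ck \<open>0 \<le> \<eta>\<close> by (intro mult_left_mono) auto
      finally have "norm ((G (z * c k) - F (z * c k)) * star (c k)) \<le> \<eta> * (norm z * norm (u k)) * norm (u k)"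
        using ck by (intro order_trans[OF norm_mult_ineq] mult_mono) (auto simp: \<open>0 \<le> \<eta>\<close>)
      then show "norm ((G (z * c k) - F (z * c k)) * star (c k)) \<le> \<eta> * norm z * (norm (u k))\<^sup>2"
        by (simp add: power2_eq_square mult.assoc)
    qed
    then show ?thesis by (simp add: square_sum_def sum_distrib_left mult_ac)
  qed
  have GF: "G \<circ> F \<in> M" using F_facts(2) G_facts(2) by (rule bimodule_maps_comp[rotated])
  obtain l where l: "(\<Sum>k<n. G (c k) * star (c k)) = l *\<^sub>C 1"
    using sum_mult_star_scalar[OF GF F_facts(2)] by (auto simp: c_def)
  \<comment> \<open>The estimate of \<open>sum_bound\<close> at \<open>1\<close> compares \<open>l\<close> with the index of \<open>C\<close>, at \<open>y\<close> it bounds \<open>l\<close> from above.\<close>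
  have "(\<Sum>k<n. F (c k) * star (c k)) = hs_square F *\<^sub>R 1"
    using hs_square_eq[OF F_facts(2)] F_facts(3,4) by (simp add: c_def)
  then have "hs_square F *\<^sub>R 1 = l *\<^sub>C 1 - (\<Sum>k<n. (G (1 * c k) - F (1 * c k)) * star (c k))"
    using l by (simp add: left_diff_distrib sum_subtractf)
  then have "norm (hs_square F *\<^sub>R (1::'b)) \<le> norm (l *\<^sub>C (1::'b)) + \<eta> * square_sum"
    using sum_bound[of 1] norm_triangle_ineq4[of "l *\<^sub>C 1" "\<Sum>k<n. (G (1 * c k) - F (1 * c k)) * star (c k)"]
    by simp
  then have l_lower: "hs_square F \<le> cmod l + \<eta> * square_sum" by (simp add: norm_scaleC hs_square_def)
  have "(\<Sum>k<n. G (y * c k) * star (c k)) = l *\<^sub>C y"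
  proof -
    have "(\<Sum>k<n. G (d * c k) * star (c k)) = d * (\<Sum>k<n. G (c k) * star (c k))"
      using bimodule_map_simps(2)[OF G_facts(1) d] by (simp add: sum_distrib_left mult.assoc)
    moreover have "(\<Sum>k<n. G (F d * c k) * star (c k)) = (\<Sum>k<n. G (c k) * star (c k)) * F d"
      unfolding c_def by (rule intermediate_central[OF F G_facts(2) F_facts(3)])
    ultimately show ?thesis
      unfolding l by (simp add: y_def left_diff_distrib bimodule_map_simps[OF G_facts(2)] sum_subtractf
          mult_scaleC_left mult_scaleC_right complex_vector.scale_right_diff_distrib)
  qed
  moreover have "F (y * c k) = 0" for k
    using bimodule_map_simps(3)[OF F_facts(1) c] F_facts(3,4)
    by (simp add: y_def bimodule_map_simps[OF F_facts(2)])
  ultimately have "(\<Sum>k<n. (G (y * c k) - F (y * c k)) * star (c k)) = l *\<^sub>C y" by simp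
  then have l_upper: "cmod l * norm y \<le> \<eta> * square_sum * norm y"
    using sum_bound[of y] by (simp add: norm_scaleC)
  have "y = 0"
  proof (rule ccontr)
    assume "y \<noteq> 0"
    then have "cmod l \<le> \<eta> * square_sum" using l_upper by simp
    then have "hs_square F * norm_sum\<^sup>2 \<le> 2 * (\<eta> * square_sum) * norm_sum\<^sup>2" using l_lower by (intro mult_right_mono) auto
    with hs_square_expectation_lower_bound[OF F] have "1 \<le> 2 * (\<eta> * square_sum) * norm_sum\<^sup>2" by linarith
    then show False using close by (simp add: \<eta>_def mult_ac)
  qed
  then show "d \<in> C" using F_facts(3)[of d] by (simp add: y_def)
qed

text \<open>
  Infinitely many expectations would contain a convergent subsequence, by contractivity and
  \<open>bounded_bimodule_maps_subsequence\<close>, and two neighbours in it would be close enough for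
  \<open>close_expectations_subset\<close> in both directions.
\<close>

lemma finite_compatible: "finite {C. compatible_intermediate A E C}"
proof (rule ccontr)
  assume "infinite {C. compatible_intermediate A E C}"
  then obtain f :: "nat \<Rightarrow> 'b set" where f: "inj f" "range f \<subseteq> {C. compatible_intermediate A E C}"
    using infinite_countable_subset by blast
  then have "\<forall>s. \<exists>F. expectation_onto (f s) F" by (auto simp: compatible_intermediate_iff)
  from choice[OF this] obtain F where F: "\<And>s. expectation_onto (f s) (F s)" by blast
  have "norm (F s (u k)) \<le> norm_sum" if "k < n" for s k
  proof -
    have "norm (F s (u k)) \<le> norm (u k)" by (rule expectation_onto_facts(8)[OF F])
    also have "\<dots> \<le> norm_sum" unfolding norm_sum_def using that by (intro member_le_sum) auto
    finally show ?thesis .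
  qed
  with expectation_onto_facts(2)[OF F] obtain r S
    where r: "strict_mono (r :: nat \<Rightarrow> nat)" and S: "\<And>x. (\<lambda>s. F (r s) x) \<longlonglongrightarrow> S x"
    using bounded_bimodule_maps_subsequence[of F norm_sum] by blast
  define \<eta> where "\<eta> s = 2 * square_sum * norm_sum\<^sup>2 * (\<Sum>k<n. norm (F (r s) (u k) - F (r (Suc s)) (u k)) * norm (u k))" for s
  have "\<eta> \<longlonglongrightarrow> 2 * square_sum * norm_sum\<^sup>2 * (\<Sum>k<n. norm (S (u k) - S (u k)) * norm (u k))"
    unfolding \<eta>_def by (intro tendsto_intros S LIMSEQ_Suc[OF S])
  then have "\<eta> \<longlonglongrightarrow> 0" by simp
  then have "\<forall>\<^sub>F s in sequentially. \<eta> s < 1" by (rule order_tendstoD) simp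
  then obtain s where s: "\<eta> s < 1" by (auto simp: eventually_sequentially)
  have "f (r (Suc s)) \<subseteq> f (r s)"
    using s by (intro close_expectations_subset[OF F F]) (simp add: \<eta>_def)
  moreover have "f (r s) \<subseteq> f (r (Suc s))"
    using s by (intro close_expectations_subset[OF F F]) (simp add: \<eta>_def norm_minus_commute)
  ultimately have "r (Suc s) = r s" using f(1) by (auto dest: injD)
  then show False using strict_monoD[OF r, of s "Suc s"] by simp
qed

section \<open>Intersections and the lattice\<close>

text \<open>
  Composition with \<open>F\<close> on the right is an orthogonal projection for the inner product of bimodule
  maps. On adjoints it is composition with \<open>F\<close> on the left, which moves values into \<open>C\<close>; the
  minimization below is therefore over norms of adjoints.
\<close>

lemma hs_square_comp_expectation:
  assumes F: "expectation_onto C F" and T: "T \<in> M"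
  shows "hs_square T = hs_square (T \<circ> F) + hs_square (\<lambda>x. T x - (T \<circ> F) x)"
proof -
  note F_facts = expectation_onto_facts[OF F]
  define R where "R x = T x - (T \<circ> F) x" for x
  have TF: "T \<circ> F \<in> M" by (rule bimodule_maps_comp[OF T F_facts(2)])
  have R: "R \<in> M" unfolding R_def by (rule M_diff[OF T TF])
  have "(\<Sum>k<n. R (u k) * star ((T \<circ> F) (u k))) = (\<Sum>k<n. R (adj (T \<circ> F) (u k)) * star (u k))"
    by (rule sum_adj_eq[OF R TF, symmetric])
  also have "\<dots> = 0"
    unfolding adj_comp[OF T F_facts(2)] adj_expectation[OF F] by (simp add: R_def F_facts(3,4))
  finally have cross: "(\<Sum>k<n. R (u k) * star ((T \<circ> F) (u k))) = 0" .
  have cross': "(\<Sum>k<n. (T \<circ> F) (u k) * star (R (u k))) = 0"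
    using arg_cong[OF cross, of star] by (simp add: star_sum)
  have "T x = (T \<circ> F) x + R x" for x by (simp add: R_def)
  then have "(\<Sum>k<n. T (u k) * star (T (u k)))
      = (\<Sum>k<n. ((T \<circ> F) (u k) + R (u k)) * star ((T \<circ> F) (u k) + R (u k)))" by (simp only:)
  also have "\<dots> = (\<Sum>k<n. (T \<circ> F) (u k) * star ((T \<circ> F) (u k)))
      + (\<Sum>k<n. (T \<circ> F) (u k) * star (R (u k))) + (\<Sum>k<n. R (u k) * star ((T \<circ> F) (u k)))
      + (\<Sum>k<n. R (u k) * star (R (u k)))"
    by (simp only: star_add distrib_left distrib_right sum.distrib) (simp only: add_ac)
  also have "\<dots> = (hs_square (T \<circ> F) + hs_square R) *\<^sub>R 1"
    unfolding cross cross' hs_square_eq[OF TF] hs_square_eq[OF R] by (simp add: scaleR_add_left)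
  finally have "hs_square T = norm ((hs_square (T \<circ> F) + hs_square R) *\<^sub>R (1::'b))" by (simp add: hs_square_def)
  also have "\<dots> = hs_square (T \<circ> F) + hs_square R" by (simp add: hs_square_def)
  finally show ?thesis by (simp add: R_def[abs_def])
qed

lemma adj_tendsto:
  assumes "\<And>x. (\<lambda>s. T s x) \<longlonglongrightarrow> T' x" shows "(\<lambda>s. adj (T s) x) \<longlonglongrightarrow> adj T' x"
  unfolding adj_def by (intro tendsto_intros E_tendsto tendsto_star assms)

lemma hs_square_tendsto:
  assumes "\<And>x. (\<lambda>s. T s x) \<longlonglongrightarrow> T' x" shows "(\<lambda>s. hs_square (T s)) \<longlonglongrightarrow> hs_square T'"
  unfolding hs_square_def by (intro tendsto_intros tendsto_star assms)

text \<open>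
  The candidates for an expectation onto \<open>N\<close>: everything required except that the range lie in
  \<open>N\<close>.
\<close>

definition averagings :: "'b set \<Rightarrow> ('b \<Rightarrow> 'b) set" where
  "averagings N = {S \<in> bimodule_maps N. (\<forall>c\<in>N. S c = c) \<and>
     (\<forall>x. nonneg x \<longrightarrow> nonneg (S x)) \<and> (\<forall>x. E (S x) = E x)}"

text \<open>
  A minimizing sequence has bounded adjoints, so these have a convergent subsequence; each
  condition on a candidate survives pointwise limits.
\<close>

lemma averagings_minimiser:
  assumes AN: "A \<subseteq> N"
  obtains P where "P \<in> averagings N" "\<And>S. S \<in> averagings N \<Longrightarrow> hs_square (adj P) \<le> hs_square (adj S)"
proof -
  let ?Q = "(\<lambda>S. hs_square (adj S)) ` averagings N"
  have "id \<in> averagings N" by (simp add: averagings_def bimodule_maps_def)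
  then have ne: "?Q \<noteq> {}" by blast
  have bdd: "bdd_below ?Q" by (rule bdd_belowI[of _ 0]) (auto simp: hs_square_def)
  define \<mu> where "\<mu> = Inf ?Q"
  have "\<forall>s. \<exists>S. S \<in> averagings N \<and> hs_square (adj S) < \<mu> + 1 / real (Suc s)"
  proof
    fix s
    have "Inf ?Q < \<mu> + 1 / real (Suc s)" by (simp add: \<mu>_def)
    then show "\<exists>S. S \<in> averagings N \<and> hs_square (adj S) < \<mu> + 1 / real (Suc s)"
      using cInf_lessD[OF ne] by blast
  qed
  from choice[OF this] obtain S where S: "\<And>s. S s \<in> averagings N"
    and S\<mu>: "\<And>s. hs_square (adj (S s)) < \<mu> + 1 / real (Suc s)" by blast
  have SM: "S s \<in> M" for s using S bimodule_maps_antimono[OF AN] by (auto simp: averagings_def)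
  have "norm (adj (S s) (u k)) \<le> sqrt (\<mu> + 1)" if "k < n" for s k
  proof (rule real_le_rsqrt)
    have "(norm (adj (S s) (u k)))\<^sup>2 \<le> hs_square (adj (S s))" by (rule norm_le_hs_square[OF that])
    also have "\<dots> \<le> \<mu> + 1 / real (Suc s)" using S\<mu>[of s] by simp
    also have "\<dots> \<le> \<mu> + 1" by simp
    finally show "(norm (adj (S s) (u k)))\<^sup>2 \<le> \<mu> + 1" .
  qed
  with adj_bimodule[OF SM] obtain r T where r: "strict_mono (r :: nat \<Rightarrow> nat)" and T: "T \<in> M"
    and lim: "\<And>x. (\<lambda>s. adj (S (r s)) x) \<longlonglongrightarrow> T x"
    using bounded_bimodule_maps_subsequence[where S = "\<lambda>s. adj (S s)" and B = "sqrt (\<mu> + 1)"] by blast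
  have P: "(\<lambda>s. S (r s) x) \<longlonglongrightarrow> adj T x" for x
    using adj_tendsto[of "\<lambda>s. adj (S (r s))" T x] lim by (simp add: adj_adj[OF SM])
  have Sr: "S (r s) \<in> bimodule_maps N" "c \<in> N \<Longrightarrow> S (r s) c = c" "nonneg x \<Longrightarrow> nonneg (S (r s) x)"
    "E (S (r s) x) = E x" for s c x
    using S[of "r s"] by (auto simp: averagings_def)
  have "adj T \<in> averagings N"
    unfolding averagings_def
  proof (intro CollectI conjI bimodule_mapsI ballI allI impI)
    show "adj T (x + y) = adj T x + adj T y" for x y
      by (rule bimodule_map_simps(1)[OF adj_bimodule[OF T]])
    fix c x assume c: "c \<in> N"
    have "(\<lambda>s. S (r s) (c * x)) \<longlonglongrightarrow> c * adj T x" "(\<lambda>s. S (r s) (x * c)) \<longlonglongrightarrow> adj T x * c"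
      using c by (auto simp: bimodule_map_simps[OF Sr(1)] intro!: tendsto_intros P)
    then show "adj T (c * x) = c * adj T x" "adj T (x * c) = adj T x * c"
      using P LIMSEQ_unique by blast+
  next
    fix c assume "c \<in> N"
    then have "(\<lambda>s. c) \<longlonglongrightarrow> adj T c" using P[of c] Sr(2) by simp
    then show "adj T c = c" by (simp add: LIMSEQ_const_iff)
  next
    fix x :: 'b assume "nonneg x"
    then show "nonneg (adj T x)"
      using closed_sequentially[OF closed_nonneg _ P[of x]] Sr(3) by simp
  next
    fix x
    have "(\<lambda>s. E x) \<longlonglongrightarrow> E (adj T x)" using E_tendsto[OF P[of x]] Sr(4) by simp
    then show "E (adj T x) = E x" by (simp add: LIMSEQ_const_iff)
  qed
  moreover have "hs_square (adj (adj T)) \<le> \<mu>"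
  proof (rule LIMSEQ_le)
    show "(\<lambda>s. hs_square (adj (S (r s)))) \<longlonglongrightarrow> hs_square (adj (adj T))"
      unfolding adj_adj[OF T] by (rule hs_square_tendsto[OF lim])
    have "(\<lambda>s. \<mu> + 1 / real (Suc s)) \<longlonglongrightarrow> \<mu> + 0"
      by (intro tendsto_intros LIMSEQ_Suc[OF lim_const_over_n])
    then show "((\<lambda>s. \<mu> + 1 / real (Suc s)) \<circ> r) \<longlonglongrightarrow> \<mu>"
      by (intro LIMSEQ_subseq_LIMSEQ r) simp
    show "\<exists>N. \<forall>s\<ge>N. hs_square (adj (S (r s))) \<le> ((\<lambda>s. \<mu> + 1 / real (Suc s)) \<circ> r) s"
      using S\<mu> less_imp_le by (auto simp del: of_nat_Suc)
  qed
  then have "hs_square (adj (adj T)) \<le> hs_square (adj S)" if "S \<in> averagings N" for S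
    using cInf_lower[OF imageI[OF that] bdd] by (simp add: \<mu>_def)
  ultimately show thesis by (rule that)
qed

text \<open>
  Let \<open>P\<close> be a candidate for \<open>C \<inter> D\<close> whose adjoint has the least Hilbert--Schmidt norm. For the
  expectation \<open>H\<close> onto \<open>C\<close> or onto \<open>D\<close> the composition \<open>H \<circ> P\<close> is again a candidate, and its
  adjoint is the projection \<open>adj P \<circ> H\<close> of \<open>adj P\<close>. By minimality the projection changes nothing, so
  \<open>H \<circ> P = P\<close>. Thus \<open>P\<close> takes its values in both algebras.
\<close>

lemma compatible_Int:
  assumes "compatible_intermediate A E C" "compatible_intermediate A E D"
  shows "compatible_intermediate A E (C \<inter> D)"
proof -
  obtain F G where F: "expectation_onto C F" and G: "expectation_onto D G"
    using assms by (auto simp: compatible_intermediate_iff)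
  have sub: "cstar_subalgebra (C \<inter> D)"
    using expectation_onto_facts(9)[OF F] expectation_onto_facts(9)[OF G]
    unfolding cstar_subalgebra_def by (auto intro: complex_vector.subspace_inter)
  have AN: "A \<subseteq> C \<inter> D" using expectation_onto_facts(10)[OF F] expectation_onto_facts(10)[OF G] by blast
  obtain P where P: "P \<in> averagings (C \<inter> D)"
    and min: "\<And>S. S \<in> averagings (C \<inter> D) \<Longrightarrow> hs_square (adj P) \<le> hs_square (adj S)"
    using averagings_minimiser[OF AN] by blast
  have PM: "P \<in> M" using P bimodule_maps_antimono[OF AN] by (auto simp: averagings_def)
  have fixed: "H \<circ> P = P" if H: "expectation_onto B H" "C \<inter> D \<subseteq> B" for B H
  proof -
    note H_facts = expectation_onto_facts[OF H(1)]
    let ?T = "adj P"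
    have T: "?T \<in> M" by (rule adj_bimodule[OF PM])
    have "H \<circ> P \<in> averagings (C \<inter> D)"
      unfolding averagings_def
    proof (intro CollectI conjI ballI allI impI)
      show "H \<circ> P \<in> bimodule_maps (C \<inter> D)"
        using P bimodule_maps_antimono[OF H(2)] H_facts(1)
        by (auto simp: averagings_def intro: bimodule_maps_comp)
    qed (use P H(2) in \<open>auto simp: averagings_def H_facts(4-6)\<close>)
    then have "hs_square ?T \<le> hs_square (?T \<circ> H)"
      using min[of "H \<circ> P"] by (simp add: adj_comp[OF H_facts(2) PM] adj_expectation[OF H(1)])
    then have "hs_square (\<lambda>x. ?T x - (?T \<circ> H) x) = 0"
      using hs_square_comp_expectation[OF H(1) T] by (simp add: hs_square_def)
    then have "?T x - (?T \<circ> H) x = 0" for x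
      by (rule hs_square_eq_0[OF M_diff[OF T bimodule_maps_comp[OF T H_facts(2)]]])
    then have "?T = ?T \<circ> H" by auto
    then have "adj ?T = adj (?T \<circ> H)" by simp
    then show ?thesis
      by (simp add: adj_comp[OF T H_facts(2)] adj_expectation[OF H(1)] adj_adj[OF PM])
  qed
  have "P x \<in> C \<inter> D" for x
    using fun_cong[OF fixed[OF F], of x] fun_cong[OF fixed[OF G], of x]
      expectation_onto_facts(3)[OF F, of "P x"] expectation_onto_facts(3)[OF G, of "P x"] by simp
  then have "conditional_expectation (C \<inter> D) P"
    using P AN one_in unfolding conditional_expectation_iff[OF sub subsetD[OF AN one_in]]
    by (auto simp: averagings_def)
  moreover have "E \<circ> P = E" using P by (auto simp: averagings_def)
  ultimately show ?thesis using sub AN unfolding compatible_intermediate_def by blast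
qed

lemma compatible_UNIV: "compatible_intermediate A E UNIV"
proof -
  have "conditional_expectation UNIV (id :: 'b \<Rightarrow> 'b)"
    unfolding conditional_expectation_iff[OF cstar_subalgebra_UNIV UNIV_I]
    by (simp add: bimodule_maps_def)
  then show ?thesis
    unfolding compatible_intermediate_def by (auto simp: cstar_subalgebra_UNIV)
qed

lemma compatible_Inter:
  assumes "finite X" "X \<noteq> {}" "\<And>C. C \<in> X \<Longrightarrow> compatible_intermediate A E C"
  shows "compatible_intermediate A E (\<Inter>X)"
  using assms by (induction X rule: finite_ne_induct) (auto intro: compatible_Int)

lemma lattice_compatible_order: "Lattice.lattice (compatible_order A E)"
proof -
  let ?L = "compatible_order A E"
  have carrier: "carrier ?L = {C. compatible_intermediate A E C}" and le: "le ?L = (\<subseteq>)"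
    by (simp_all add: compatible_order_def)
  interpret partial_order ?L
    by unfold_locales (auto simp: compatible_order_def)
  show ?thesis
  proof
    fix C D assume "C \<in> carrier ?L" "D \<in> carrier ?L"
    then have C: "compatible_intermediate A E C" and D: "compatible_intermediate A E D"
      by (simp_all add: carrier)
    let ?U = "{X. compatible_intermediate A E X \<and> C \<subseteq> X \<and> D \<subseteq> X}"
    have "compatible_intermediate A E (\<Inter>?U)"
      using compatible_UNIV by (intro compatible_Inter finite_subset[OF _ finite_compatible]) auto
    then show "\<exists>s. least ?L s (Upper ?L {C, D})"
      by (intro exI[of _ "\<Inter>?U"]) (auto simp: least_def Upper_def carrier le C D)
    show "\<exists>s. greatest ?L s (Lower ?L {C, D})"
      using compatible_Int[OF C D]
      by (intro exI[of _ "C \<inter> D"]) (auto simp: greatest_def Lower_def carrier le C D)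
  qed
qed

end

theorem corollary10p6:
  fixes A :: "'b::cstar_algebra set" and E :: "'b \<Rightarrow> 'b"
  assumes "finite_index_inclusion A E"
    and "irreducible_inclusion A"
  shows "Lattice.lattice (compatible_order A E) \<and> finite (carrier (compatible_order A E))"
proof -
  obtain n u where "irreducible_finite_index A E n u"
    using assms unfolding finite_index_inclusion_def irreducible_finite_index_def by blast
  then interpret irreducible_finite_index A E n u .
  show ?thesis
    using lattice_compatible_order finite_compatible by (simp add: compatible_order_def)
qed

end
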